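(* Let $A\in\mathbb{R}^{n\times n}$ be a matrix with $\sigma(A)\cap(-\infty,0]=\emptyset$. Let $k\ge 2$, let $p(\lambda)=\lambda^k+c_1\lambda^{k-1}+\cdots+c_{k-1}\lambda+c_k$ be a polynomial with real coefficients such that $p(I-A)=0$, and let $C\in\mathbb{R}^{k\times k}$ be the companion matrix of $p$. Let $\mathcal{D}=\{t\in\mathbb{R}:\sigma(I-(I-A)t)\cap(-\infty,0]=\emptyset\}$, and suppose that $[f_1(t),\ldots,f_k(t)]^T$ is the solution in $\mathcal{D}$ of the initial value problem $$(I-Ct)\,\dot{x}(t)=-e_2,\qquad x(0)=0,$$ where $e_2=[0\;1\;0\;\cdots\;0]^T\in\mathbb{R}^k$. Then $$\log\bigl(I(1-t)+At\bigr)=f_1(t)I+f_2(t)(I-A)+\cdots+f_k(t)(I-A)^{k-1}$$ for all $t\in[0,1]$, and more generally for all $t\in\mathcal{D}$. In particular, $$\log A=f_1(1)I+f_2(1)(I-A)+\cdots+f_k(1)(I-A)^{k-1}.$$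
   Context: $\sigma(X)$ denotes the spectrum (set of complex eigenvalues) of a matrix $X$, and $I$ is the identity matrix of the appropriate size. The companion matrix of $p(\lambda)=\lambda^k+c_1\lambda^{k-1}+\cdots+c_k$ is $$C=\begin{bmatrix}0&0&\cdots&0&-c_k\\1&0&\cdots&0&-c_{k-1}\\0&1&\cdots&0&-c_{k-2}\\ \vdots&&\ddots&&\vdots\\0&0&\cdots&1&-c_1\end{bmatrix},$$ that is, the first $k-1$ columns consist of a zero row on top of the identity matrix $I_{k-1}$, and the last column is $[-c_k,-c_{k-1},\ldots,-c_1]^T$. A solution in $\mathcal{D}$ of the initial value problem means a function $x:\mathcal{D}\to\mathbb{R}^k$, differentiable on $\mathcal{D}$, satisfying the equation at every $t\in\mathcal{D}$ and the initial condition at $t=0$. For a real square matrix $B$ with no eigenvalues on the closed negative real axis $(-\infty,0]$, $\log B$ denotes the principal logarithm of $B$: the unique real matrix $X$ with $e^X=B$ all of whose eigenvalues lie in the open strip $\{z\in\mathbb{C}:-\pi<\operatorname{Im} z<\pi\}$. *)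

theory Defs
  imports "Jordan_Normal_Form.Spectral_Radius"
begin

text \<open>A real matrix is read as a complex one, so that its spectrum also contains
  the non-real eigenvalues.\<close>

definition cspectrum :: "real mat \<Rightarrow> complex set" where
  "cspectrum X = spectrum (map_mat complex_of_real X)"

definition closed_negative_axis :: "complex set" where
  "closed_negative_axis = complex_of_real ` {..0}"

text \<open>The matrix \<open>c 0 I + c 1 X + \<dots> + c (m - 1) X^(m-1)\<close>. It is written entrywise because
  the dimension is not part of the type \<open>real mat\<close>, so that there is no generic zero
  matrix and hence no \<open>sum\<close> of matrices.\<close>

definition mat_power_sum :: "(nat \<Rightarrow> real) \<Rightarrow> nat \<Rightarrow> real mat \<Rightarrow> real mat" where
  "mat_power_sum c m X =
     mat (dim_row X) (dim_row X) (\<lambda>(i, j). \<Sum>l<m. c l * (X ^\<^sub>m l) $$ (i, j))"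

definition poly_mat :: "real poly \<Rightarrow> real mat \<Rightarrow> real mat" where
  "poly_mat p X = mat_power_sum (coeff p) (Suc (degree p)) X"

text \<open>The series converges entrywise for every square matrix.\<close>

definition exp_mat :: "real mat \<Rightarrow> real mat" where
  "exp_mat X = mat (dim_row X) (dim_row X) (\<lambda>(i, j). \<Sum>l. (X ^\<^sub>m l) $$ (i, j) / fact l)"

text \<open>The principal logarithm; meaningful only if \<open>B\<close> is square and \<open>cspectrum B\<close> is disjoint
  from \<open>closed_negative_axis\<close>.\<close>

definition log_mat :: "real mat \<Rightarrow> real mat" where
  "log_mat B = (THE X. X \<in> carrier_mat (dim_row B) (dim_row B) \<and> exp_mat X = B \<and>
     (\<forall>z\<in>cspectrum X. - pi < Im z \<and> Im z < pi))"

text \<open>For monic \<open>p\<close> of degree \<open>k\<close>, written \<open>\<lambda>^k + c\<^sub>1 \<lambda>^(k-1) + \<dots> + c\<^sub>k\<close>, the coefficient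
  \<open>c\<^sub>j\<close> is \<open>coeff p (k - j)\<close>. Indices start at 0, so row \<open>i\<close> of the last column,
  \<open>- c\<^bsub>k-i\<^esub>\<close>, is \<open>- coeff p i\<close>.\<close>

definition companion_mat :: "real poly \<Rightarrow> real mat" where
  "companion_mat p = mat (degree p) (degree p) (\<lambda>(i, j).
     if j = degree p - 1 then - coeff p i else if i = Suc j then 1 else 0)"

text \<open>\<open>x\<close> solves \<open>L(t) x'(t) = b\<close>, \<open>x(0) = x\<^sub>0\<close> on \<open>D\<close>, with values in the vectors
  of dimension \<open>k\<close>; \<open>v\<close> is the derivative of \<open>x\<close> at \<open>t\<close>.\<close>

definition ivp_solution ::
  "nat \<Rightarrow> real set \<Rightarrow> (real \<Rightarrow> real mat) \<Rightarrow> real vec \<Rightarrow> real vec \<Rightarrow> (real \<Rightarrow> real vec) \<Rightarrow> bool" where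
  "ivp_solution k D L b x0 x \<longleftrightarrow>
     (\<forall>t\<in>D. x t \<in> carrier_vec k) \<and>
     (\<forall>t\<in>D. \<exists>v\<in>carrier_vec k.
        (\<forall>i<k. ((\<lambda>s. x s $ i) has_real_derivative v $ i) (at t within D)) \<and>
        L t *\<^sub>v v = b) \<and>
     x 0 = x0"

end

(*
  Let N = I - A and X(t) = f_1(t) I + ... + f_k(t) N^(k-1). Multiplication by N acts on
  coefficient vectors through the companion matrix, modulo p(N) = 0, so the initial value
  problem says (I - tN) X'(t) = -N. As X(t) commutes with N, the matrix exp(-X(t)) (I - tN) has
  derivative 0 on the interval D, whence exp X(t) = I - tN; no inverse is needed.

  Every eigenvalue of X(t) is the value h(t) of a continuous curve with h(0) = 0 and
  exp (h(s)) = 1 - s z outside (-oo, 0], for z an eigenvalue of N. Such a curve never meets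
  Im = pi or Im = -pi.

  Any other logarithm Y of I - tN commutes with I - tN, hence (t = 0 is trivial) with N and X(t),
  and exp (X(t) - Y) = I together with the strip condition forces X(t) = Y.
*)
theory Submission
  imports Defs
begin

section \<open>The exponential of a real matrix\<close>

text \<open>Since the size of a matrix is not part of its type, convergence, derivatives and the
  functional equation of \<open>exp_mat\<close> are all handled entry by entry. As \<open>p\<close>
  may have roots that are not eigenvalues of N, the matrix I - tC can be singular at points of D.
  The system is therefore never solved for x'(t); it is only transported to an identity between
  matrices. D is an interval because it is cut out by the conditions 1 - tq > 0, with q running
  through the real eigenvalues of N, and each of them is affine in t. Jordan forms are avoided:
  commuting matrices share an eigenvector in every nonzero subspace that both leave invariant. This
  attaches to an eigenvalue of X(t) an eigenvector of N, which is then an eigenvector of X(s) for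
  all s at once and yields the curve h. It also drives uniqueness, inside the range of X(t) - Y: on
  a common eigenvector there, the eigenvalues of X(t) and Y differ by a multiple of 2 pi i of
  modulus less than 2 pi, hence agree. So X(t) - Y would be nonzero and act nilpotently somewhere,
  which its exponential being I excludes.\<close>

lemma index_mult_mat_sum:
  assumes "A \<in> carrier_mat n m" "B \<in> carrier_mat m l" "i < n" "j < l"
  shows "(A * B) $$ (i, j) = (\<Sum>r<m. A $$ (i, r) * B $$ (r, j))"
  using assms by (simp add: scalar_prod_def lessThan_atLeast0)

lemma index_mult_mat_vec_sum:
  assumes "A \<in> carrier_mat n m" "v \<in> carrier_vec m" "i < n"
  shows "(A *\<^sub>v v) $ i = (\<Sum>r<m. A $$ (i, r) * v $ r)"
  using assms by (simp add: scalar_prod_def lessThan_atLeast0)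

lemma pow_mat_commute:
  assumes X: "X \<in> carrier_mat n n" and Y: "Y \<in> carrier_mat n n" and XY: "X * Y = Y * X"
  shows "X ^\<^sub>m l * Y = Y * X ^\<^sub>m l"
proof (induction l)
  case (Suc l)
  have P: "X ^\<^sub>m l \<in> carrier_mat n n" using X by simp
  have "X ^\<^sub>m Suc l * Y = X ^\<^sub>m l * (X * Y)"
    using X Y P by (simp add: assoc_mult_mat[of _ n n _ n _ n])
  also have "\<dots> = (X ^\<^sub>m l * Y) * X"
    unfolding XY using X Y P by (simp add: assoc_mult_mat[of _ n n _ n _ n])
  also have "\<dots> = Y * X ^\<^sub>m Suc l"
    unfolding Suc using X Y P by (simp add: assoc_mult_mat[of _ n n _ n _ n])
  finally show ?case .
qed (use X Y in simp)

lemma pow_mat_smult: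
  fixes M :: "'a :: comm_ring_1 mat"
  assumes "M \<in> carrier_mat n n"
  shows "(s \<cdot>\<^sub>m M) ^\<^sub>m l = s ^ l \<cdot>\<^sub>m (M ^\<^sub>m l)"
proof (induction l)
  case (Suc l)
  have P: "M ^\<^sub>m l \<in> carrier_mat n n" using assms by simp
  show ?case
    unfolding pow_mat.simps Suc mult_smult_assoc_mat[OF P smult_carrier_mat[OF assms]]
      mult_smult_distrib[OF P assms]
    using assms by (intro eq_matI) (auto simp: mult_ac)
qed (use assms in \<open>auto intro!: eq_matI\<close>)

text \<open>Geometric growth of the entries lets the scalar series of exp \<open>c\<close> dominate
  every entry of the matrix series. The constant \<open>c\<close> is the sum of the absolute values
  of all entries; it bounds each column sum, so one more factor \<open>X\<close> costs at most one
  factor \<open>c\<close>.\<close>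

lemma pow_mat_entry_bound:
  fixes X :: "real mat"
  assumes X: "X \<in> carrier_mat n n"
  obtains c where "c \<ge> 0"
    "\<And>l i j. i < n \<Longrightarrow> j < n \<Longrightarrow> \<bar>(X ^\<^sub>m l) $$ (i, j)\<bar> \<le> c ^ l"
proof -
  define c where "c = (\<Sum>i<n. \<Sum>j<n. \<bar>X $$ (i, j)\<bar>)"
  have c0: "c \<ge> 0" unfolding c_def by (intro sum_nonneg) auto
  have bound: "\<bar>(X ^\<^sub>m l) $$ (i, j)\<bar> \<le> c ^ l" if "i < n" "j < n" for l i j
    using that
  proof (induction l arbitrary: i j)
    case (Suc l)
    have "(X ^\<^sub>m Suc l) $$ (i, j) = (\<Sum>r<n. (X ^\<^sub>m l) $$ (i, r) * X $$ (r, j))"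
      using Suc.prems X index_mult_mat_sum[of "X ^\<^sub>m l" n n X n] by simp
    also have "\<bar>\<dots>\<bar> \<le> (\<Sum>r<n. \<bar>(X ^\<^sub>m l) $$ (i, r)\<bar> * \<bar>X $$ (r, j)\<bar>)"
      using sum_abs by (simp add: abs_mult[symmetric])
    also have "\<dots> \<le> (\<Sum>r<n. c ^ l * \<bar>X $$ (r, j)\<bar>)"
      using Suc by (intro sum_mono mult_right_mono) auto
    also have "\<dots> = c ^ l * (\<Sum>r<n. \<bar>X $$ (r, j)\<bar>)" by (simp add: sum_distrib_left)
    also have "\<dots> \<le> c ^ l * c"
    proof (intro mult_left_mono)
      show "(\<Sum>r<n. \<bar>X $$ (r, j)\<bar>) \<le> c" unfolding c_def
        using Suc.prems by (intro sum_mono member_le_sum) auto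
    qed (use c0 in auto)
    finally show ?case by (simp add: mult.commute)
  qed (use X in auto)
  show ?thesis using that[OF c0 bound] by blast
qed

lemma summable_exp_mat:
  fixes X :: "real mat"
  assumes "X \<in> carrier_mat n n" "i < n" "j < n"
  shows "summable (\<lambda>l. norm ((X ^\<^sub>m l) $$ (i, j) / fact l))"
proof -
  obtain c where c: "c \<ge> 0" "\<And>l. \<bar>(X ^\<^sub>m l) $$ (i, j)\<bar> \<le> c ^ l"
    using pow_mat_entry_bound[OF assms(1)] assms by metis
  have "summable (\<lambda>l. c ^ l / fact l)"
    using summable_exp[of c] by (simp add: field_simps)
  then show ?thesis
    by (rule summable_comparison_test') (use c in \<open>simp add: divide_right_mono\<close>)
qed

lemma exp_mat_carrier [simp]: "X \<in> carrier_mat n n \<Longrightarrow> exp_mat X \<in> carrier_mat n n"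
  by (auto simp: exp_mat_def)

lemma exp_mat_index:
  "X \<in> carrier_mat n n \<Longrightarrow> i < n \<Longrightarrow> j < n \<Longrightarrow>
    exp_mat X $$ (i, j) = (\<Sum>l. (X ^\<^sub>m l) $$ (i, j) / fact l)"
  by (auto simp: exp_mat_def)

lemma exp_mat_sums:
  assumes "X \<in> carrier_mat n n" "i < n" "j < n"
  shows "(\<lambda>l. (X ^\<^sub>m l) $$ (i, j) / fact l) sums exp_mat X $$ (i, j)"
  using summable_norm_cancel[OF summable_exp_mat[OF assms]] assms
  by (simp add: exp_mat_index summable_sums)

text \<open>An entry of a product with \<open>Y\<close> is a finite combination of convergent
  series, so the commutation of \<open>Y\<close> with each power passes to the limit.\<close>

lemma exp_mat_commute:
  assumes X: "X \<in> carrier_mat n n" and Y: "Y \<in> carrier_mat n n" and "X * Y = Y * X"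
  shows "exp_mat X * Y = Y * exp_mat X"
proof (rule eq_matI)
  fix i j assume "i < dim_row (Y * exp_mat X)" "j < dim_col (Y * exp_mat X)"
  then have ij: "i < n" "j < n" using assms by (auto simp: exp_mat_def)
  have "(\<lambda>l. \<Sum>r<n. (X ^\<^sub>m l) $$ (i, r) / fact l * Y $$ (r, j)) sums
      (\<Sum>r<n. exp_mat X $$ (i, r) * Y $$ (r, j))"
    using X ij by (intro sums_sum sums_mult2 exp_mat_sums) auto
  moreover have "(\<lambda>l. \<Sum>r<n. Y $$ (i, r) * ((X ^\<^sub>m l) $$ (r, j) / fact l)) sums
      (\<Sum>r<n. Y $$ (i, r) * exp_mat X $$ (r, j))"
    using X ij by (intro sums_sum sums_mult exp_mat_sums) auto
  moreover have "(\<Sum>r<n. (X ^\<^sub>m l) $$ (i, r) / fact l * Y $$ (r, j)) =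
      (\<Sum>r<n. Y $$ (i, r) * ((X ^\<^sub>m l) $$ (r, j) / fact l))" for l
  proof -
    have "(X ^\<^sub>m l * Y) $$ (i, j) = (Y * X ^\<^sub>m l) $$ (i, j)"
      using pow_mat_commute[OF assms] by simp
    then show ?thesis
      using index_mult_mat_sum[of "X ^\<^sub>m l" n n Y n i j] index_mult_mat_sum[of Y n n "X ^\<^sub>m l" n i j] X Y ij
      by (simp add: sum_divide_distrib[symmetric])
  qed
  ultimately show "(exp_mat X * Y) $$ (i, j) = (Y * exp_mat X) $$ (i, j)"
    using X Y ij index_mult_mat_sum[of "exp_mat X" n n Y n i j]
      index_mult_mat_sum[of Y n n "exp_mat X" n i j]
    by (simp add: sums_unique2)
qed (use assms in \<open>auto simp: exp_mat_def\<close>)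

lemma exp_mat_zero: "exp_mat (0\<^sub>m n n) = 1\<^sub>m n"
proof (rule eq_matI)
  fix i j assume "i < dim_row (1\<^sub>m n)" "j < dim_col (1\<^sub>m n)"
  then have ij: "i < n" "j < n" by auto
  have "((0\<^sub>m n n :: real mat) ^\<^sub>m l) $$ (i, j) / fact l = 0" if "l \<notin> {0}" for l
    using that ij by (cases l) auto
  then have "(\<Sum>l. ((0\<^sub>m n n :: real mat) ^\<^sub>m l) $$ (i, j) / fact l) =
      (\<Sum>l\<in>{0}. ((0\<^sub>m n n :: real mat) ^\<^sub>m l) $$ (i, j) / fact l)"
    by (intro suminf_finite) auto
  then show "exp_mat (0\<^sub>m n n) $$ (i, j) = 1\<^sub>m n $$ (i, j)"
    using ij exp_mat_index[of "0\<^sub>m n n" n i j] by auto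
qed (auto simp: exp_mat_def)

text \<open>The binomial theorem for commuting matrices, read off at one entry. The column
  \<open>j\<close> varies in the induction because expanding the last factor visits every column of
  the preceding power.\<close>

lemma add_pow_mat_index:
  fixes X Y :: "'a :: comm_ring_1 mat"
  assumes X: "X \<in> carrier_mat n n" and Y: "Y \<in> carrier_mat n n" and XY: "X * Y = Y * X"
    and i: "i < n" and "j < n"
  shows "((X + Y) ^\<^sub>m m) $$ (i, j) = (\<Sum>l\<le>m. of_nat (m choose l) * (X ^\<^sub>m l * Y ^\<^sub>m (m - l)) $$ (i, j))"
  using \<open>j < n\<close>
proof (induction m arbitrary: j)
  case 0
  then show ?case using X Y i by simp
next
  case (Suc m)
  define g where "g a b = (X ^\<^sub>m a * Y ^\<^sub>m b) $$ (i, j)" for a b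
  have P: "X ^\<^sub>m a \<in> carrier_mat n n" "Y ^\<^sub>m a \<in> carrier_mat n n" for a using X Y by auto
  have XS: "X ^\<^sub>m a * Y ^\<^sub>m b * X = X ^\<^sub>m Suc a * Y ^\<^sub>m b" for a b
    unfolding pow_mat.simps assoc_mult_mat[OF P(1) P(2) X] assoc_mult_mat[OF P(1) X P(2)]
      pow_mat_commute[OF Y X XY[symmetric]] ..
  have YS: "X ^\<^sub>m a * Y ^\<^sub>m b * Y = X ^\<^sub>m a * Y ^\<^sub>m Suc b" for a b
    unfolding pow_mat.simps assoc_mult_mat[OF P(1) P(2) Y] ..
  \<comment> \<open>Multiplying on the right by \<open>X + Y\<close> raises one of the two
    exponents; commutation moves the new \<open>X\<close> to the left past the powers of
    \<open>Y\<close>.\<close>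
  have step: "(\<Sum>r<n. (X ^\<^sub>m a * Y ^\<^sub>m b) $$ (i, r) * (X $$ (r, j) + Y $$ (r, j))) =
      g (Suc a) b + g a (Suc b)" for a b
  proof -
    have G: "X ^\<^sub>m a * Y ^\<^sub>m b \<in> carrier_mat n n" by (rule mult_carrier_mat[OF P(1) P(2)])
    have "g (Suc a) b = (\<Sum>r<n. (X ^\<^sub>m a * Y ^\<^sub>m b) $$ (i, r) * X $$ (r, j))"
      "g a (Suc b) = (\<Sum>r<n. (X ^\<^sub>m a * Y ^\<^sub>m b) $$ (i, r) * Y $$ (r, j))"
      unfolding g_def
      by (simp_all only: XS[symmetric, of a b] YS[symmetric, of a b]
          index_mult_mat_sum[OF G X i Suc.prems] index_mult_mat_sum[OF G Y i Suc.prems])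
    then show ?thesis by (simp only: sum.distrib distrib_left)
  qed
  have "((X + Y) ^\<^sub>m Suc m) $$ (i, j) = (\<Sum>r<n. ((X + Y) ^\<^sub>m m) $$ (i, r) * (X + Y) $$ (r, j))"
    using X Y i Suc.prems index_mult_mat_sum[of "(X + Y) ^\<^sub>m m" n n "X + Y" n i j] by simp
  also have "\<dots> = (\<Sum>r<n. \<Sum>l\<le>m. of_nat (m choose l) *
      ((X ^\<^sub>m l * Y ^\<^sub>m (m - l)) $$ (i, r) * (X $$ (r, j) + Y $$ (r, j))))"
    using X Y i by (intro sum.cong refl) (simp add: Suc.IH Suc.prems sum_distrib_right mult.assoc)
  also have "\<dots> = (\<Sum>l\<le>m. of_nat (m choose l) * (g (Suc l) (m - l) + g l (Suc (m - l))))"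
    unfolding step[symmetric] sum_distrib_left by (rule sum.swap)
  also have "\<dots> = (\<Sum>l\<le>m. of_nat (m choose l) * g (Suc l) (m - l)) +
      (\<Sum>l\<le>m. of_nat (m choose l) * g l (Suc m - l))"
    by (simp add: sum.distrib distrib_left Suc_diff_le)
  \<comment> \<open>Shifting the index prepares Pascal's rule. The shifted sum may run up to
    \<open>m\<close> again because its last binomial coefficient, \<open>m choose Suc m\<close>, is
    0.\<close>
  also have "(\<Sum>l\<le>m. of_nat (m choose l) * g l (Suc m - l)) =
      g 0 (Suc m) + (\<Sum>l\<le>m. of_nat (m choose Suc l) * g (Suc l) (m - l))"
    using sum.atMost_Suc_shift[of "\<lambda>l. of_nat (m choose l) * g l (Suc m - l)" m]
    by (simp add: binomial_eq_0)
  also have "(\<Sum>l\<le>m. of_nat (m choose l) * g (Suc l) (m - l)) +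
      (g 0 (Suc m) + (\<Sum>l\<le>m. of_nat (m choose Suc l) * g (Suc l) (m - l))) =
      g 0 (Suc m) + (\<Sum>l\<le>m. of_nat (Suc m choose Suc l) * g (Suc l) (m - l))"
    by (simp add: sum.distrib distrib_right)
  also have "\<dots> = (\<Sum>l\<le>Suc m. of_nat (Suc m choose l) * g l (Suc m - l))"
    by (subst sum.atMost_Suc_shift) simp
  finally show ?case by (simp add: g_def)
qed

text \<open>Each entry of the product is a finite sum of Cauchy products of absolutely convergent
  series; the binomial theorem recognises the \<open>m\<close>-th term as the entry of (X + Y)^m /
  m!.\<close>

lemma exp_mat_add:
  assumes X: "X \<in> carrier_mat n n" and Y: "Y \<in> carrier_mat n n" and XY: "X * Y = Y * X"
  shows "exp_mat (X + Y) = exp_mat X * exp_mat Y"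
proof (rule eq_matI)
  fix i j assume "i < dim_row (exp_mat X * exp_mat Y)" "j < dim_col (exp_mat X * exp_mat Y)"
  then have ij: "i < n" "j < n" using assms by (auto simp: exp_mat_def)
  let ?a = "\<lambda>r l. (X ^\<^sub>m l) $$ (i, r) / fact l" and ?b = "\<lambda>r l. (Y ^\<^sub>m l) $$ (r, j) / fact l"
  have "(\<lambda>m. \<Sum>r<n. \<Sum>l\<le>m. ?a r l * ?b r (m - l)) sums
      (\<Sum>r<n. exp_mat X $$ (i, r) * exp_mat Y $$ (r, j))"
  proof (intro sums_sum)
    fix r assume "r \<in> {..<n}"
    then have "r < n" by simp
    then show "(\<lambda>m. \<Sum>l\<le>m. ?a r l * ?b r (m - l)) sums (exp_mat X $$ (i, r) * exp_mat Y $$ (r, j))"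
      unfolding exp_mat_index[OF X ij(1) \<open>r < n\<close>] exp_mat_index[OF Y \<open>r < n\<close> ij(2)]
      using X Y ij by (intro Cauchy_product_sums summable_exp_mat)
  qed
  moreover have "(\<Sum>r<n. \<Sum>l\<le>m. ?a r l * ?b r (m - l)) = ((X + Y) ^\<^sub>m m) $$ (i, j) / fact m" for m
  proof -
    have "(\<Sum>r<n. \<Sum>l\<le>m. ?a r l * ?b r (m - l)) =
        (\<Sum>l\<le>m. (X ^\<^sub>m l * Y ^\<^sub>m (m - l)) $$ (i, j) / (fact l * fact (m - l)))"
    proof (subst sum.swap, intro sum.cong refl)
      fix l
      show "(\<Sum>r<n. ?a r l * ?b r (m - l)) = (X ^\<^sub>m l * Y ^\<^sub>m (m - l)) $$ (i, j) / (fact l * fact (m - l))"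
        using index_mult_mat_sum[of "X ^\<^sub>m l" n n "Y ^\<^sub>m (m - l)" n i j] X Y ij
        by (simp add: sum_divide_distrib)
    qed
    also have "\<dots> = ((X + Y) ^\<^sub>m m) $$ (i, j) / fact m"
      unfolding add_pow_mat_index[OF X Y XY ij] sum_divide_distrib
      by (auto intro!: sum.cong simp: binomial_fact)
    finally show ?thesis .
  qed
  ultimately have "(\<lambda>m. ((X + Y) ^\<^sub>m m) $$ (i, j) / fact m) sums (exp_mat X * exp_mat Y) $$ (i, j)"
    using index_mult_mat_sum[of "exp_mat X" n n "exp_mat Y" n i j] X Y ij by simp
  moreover have "(\<lambda>m. ((X + Y) ^\<^sub>m m) $$ (i, j) / fact m) sums exp_mat (X + Y) $$ (i, j)"
    using X Y ij by (intro exp_mat_sums) auto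
  ultimately show "exp_mat (X + Y) $$ (i, j) = (exp_mat X * exp_mat Y) $$ (i, j)"
    by (rule sums_unique2[symmetric])
qed (use assms in \<open>auto simp: exp_mat_def\<close>)

lemma exp_mat_uminus_right:
  assumes "X \<in> carrier_mat n n"
  shows "exp_mat X * exp_mat (- X) = 1\<^sub>m n"
proof -
  have "exp_mat X * exp_mat (- X) = exp_mat (X + - X)"
    using assms by (intro exp_mat_add[symmetric]) auto
  also have "X + - X = 0\<^sub>m n n" using assms by (intro eq_matI) auto
  finally show ?thesis by (simp add: exp_mat_zero)
qed

text \<open>For fixed \<open>M\<close> an entry is a scalar power series in \<open>s\<close> that
  converges everywhere, so it may be differentiated termwise; the index shift of the derived series
  produces the factor \<open>M\<close>.\<close>

lemma exp_mat_smult_deriv: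
  assumes M: "M \<in> carrier_mat n n" and ij: "i < n" "j < n"
  shows "((\<lambda>s. exp_mat (s \<cdot>\<^sub>m M) $$ (i, j)) has_real_derivative (M * exp_mat (s \<cdot>\<^sub>m M)) $$ (i, j)) (at s)"
proof -
  define c where "c l = (M ^\<^sub>m l) $$ (i, j) / fact l" for l
  have pow: "((y \<cdot>\<^sub>m M) ^\<^sub>m l) $$ (a, b) = y ^ l * (M ^\<^sub>m l) $$ (a, b)" if "a < n" "b < n" for y a b l
    using M that by (simp add: pow_mat_smult[OF M])
  have sums: "(\<lambda>l. c l * y ^ l) sums exp_mat (y \<cdot>\<^sub>m M) $$ (i, j)" for y
    using exp_mat_sums[of "y \<cdot>\<^sub>m M" n i j] M ij by (simp add: pow c_def mult.commute)
  have "((\<lambda>s. \<Sum>l. c l * s ^ l) has_real_derivative (\<Sum>l. diffs c l * s ^ l)) (at s)"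
    using sums by (intro termdiffs_strong_converges_everywhere) (auto simp: sums_iff)
  moreover have "(\<lambda>l. \<Sum>r<n. M $$ (i, r) * (((s \<cdot>\<^sub>m M) ^\<^sub>m l) $$ (r, j) / fact l)) sums
      (\<Sum>r<n. M $$ (i, r) * exp_mat (s \<cdot>\<^sub>m M) $$ (r, j))"
    using M ij by (intro sums_sum sums_mult exp_mat_sums) auto
  moreover have "(\<Sum>r<n. M $$ (i, r) * (((s \<cdot>\<^sub>m M) ^\<^sub>m l) $$ (r, j) / fact l)) = diffs c l * s ^ l" for l
  proof -
    have "(M ^\<^sub>m Suc l) $$ (i, j) = (\<Sum>r<n. M $$ (i, r) * (M ^\<^sub>m l) $$ (r, j))"
      using index_mult_mat_sum[of M n n "M ^\<^sub>m l" n i j] M ij pow_mat_commute[OF M M refl, of l] by simp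
    then show ?thesis using ij
      by (simp add: pow diffs_def c_def sum_distrib_right sum_distrib_left sum_divide_distrib
          divide_simps mult_ac del: pow_mat.simps)
  qed
  ultimately show ?thesis
    using sums index_mult_mat_sum[of M n n "exp_mat (s \<cdot>\<^sub>m M)" n i j] M ij
    by (simp add: sums_iff)
qed

section \<open>Eigenvectors in invariant subspaces\<close>

lemma linear_dependence_vec:
  fixes K :: "nat \<Rightarrow> 'a :: field vec"
  assumes K: "\<And>i. K i \<in> carrier_vec n"
  obtains c where "\<exists>i\<le>n. c i \<noteq> 0" "\<And>a. a < n \<Longrightarrow> (\<Sum>i\<le>n. c i * K i $ a) = 0"
proof -
  \<comment> \<open>Padding with a zero row makes a singular square matrix; its kernel gives the coefficients.\<close>
  define M where "M = mat (Suc n) (Suc n) (\<lambda>(a, i). if a < n then K i $ a else 0)"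
  have M: "M \<in> carrier_mat (Suc n) (Suc n)" by (simp add: M_def)
  have "transpose_mat M *\<^sub>v unit_vec (Suc n) n = 0\<^sub>v (Suc n)"
    by (rule eq_vecI) (auto simp: M_def)
  moreover have "unit_vec (Suc n) n \<noteq> (0\<^sub>v (Suc n) :: 'a vec)"
    by (auto dest: arg_cong[where f = "\<lambda>v. v $ n"])
  ultimately have "det (transpose_mat M) = 0"
    using M by (subst det_0_iff_vec_prod_zero_field[of _ "Suc n"]) (auto intro!: exI[of _ "unit_vec (Suc n) n"])
  then have "det M = 0" using det_transpose[OF M] by simp
  then obtain v where v: "v \<in> carrier_vec (Suc n)" "v \<noteq> 0\<^sub>v (Suc n)" "M *\<^sub>v v = 0\<^sub>v (Suc n)"
    using det_0_iff_vec_prod_zero_field[OF M] by auto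
  have "\<exists>i\<le>n. v $ i \<noteq> 0"
    using v(1,2) by (metis carrier_vecD eq_vecI index_zero_vec(1) index_zero_vec(2) less_Suc_eq_le)
  moreover have "(\<Sum>i\<le>n. v $ i * K i $ a) = 0" if "a < n" for a
  proof -
    have "(M *\<^sub>v v) $ a = 0" using v(3) that by simp
    then show ?thesis
      using index_mult_mat_vec_sum[OF M v(1), of a] that
      by (simp add: M_def lessThan_Suc_atMost mult.commute)
  qed
  ultimately show ?thesis using that by blast
qed

text \<open>Induction on the degree of a polynomial q with q(X) w = 0. Over the complex numbers q =
  (x - z) r, and then either (X - z) w = 0, so that \<open>w\<close> is an eigenvector, or (X - z) w
  is a nonzero element of \<open>S\<close> annihilated by the shorter polynomial
  \<open>r\<close>.\<close>

lemma eigenvector_in_annihilated_subspace: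
  fixes X :: "complex mat"
  assumes X: "X \<in> carrier_mat n n" and S: "S \<subseteq> carrier_vec n"
    and add: "\<And>v w. v \<in> S \<Longrightarrow> w \<in> S \<Longrightarrow> v + w \<in> S"
    and smult: "\<And>c v. v \<in> S \<Longrightarrow> c \<cdot>\<^sub>v v \<in> S"
    and inv: "\<And>v. v \<in> S \<Longrightarrow> X *\<^sub>v v \<in> S"
    and "q \<noteq> 0" "w \<in> S" "w \<noteq> 0\<^sub>v n"
    and "\<And>a. a < n \<Longrightarrow> (\<Sum>i\<le>degree q. coeff q i * (X ^\<^sub>m i *\<^sub>v w) $ a) = 0"
  shows "\<exists>u\<in>S. u \<noteq> 0\<^sub>v n \<and> (\<exists>z. X *\<^sub>v u = z \<cdot>\<^sub>v u)"
  using assms(6-9)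
proof (induction "degree q" arbitrary: q w)
  case 0
  have w: "w \<in> carrier_vec n" using 0 S by auto
  have "coeff q 0 \<noteq> 0" using 0 by (metis leading_coeff_0_iff)
  moreover have "coeff q 0 * w $ a = 0" if "a < n" for a
    using 0(5)[OF that] 0(1)[symmetric] w X by simp
  ultimately have "w = 0\<^sub>v n" using w by (intro eq_vecI) auto
  then show ?case using 0 by simp
next
  case (Suc d)
  have w: "w \<in> carrier_vec n" using Suc S by auto
  obtain z where "poly q z = 0"
    using fundamental_theorem_of_algebra[of q] Suc.hyps(2) constant_degree[of q] by auto
  then obtain r where q: "q = [:- z, 1:] * r" by (auto simp: poly_eq_0_iff_dvd)
  have r0: "r \<noteq> 0" using q Suc.prems(1) by auto
  then have "degree q = Suc (degree r)" unfolding q by (subst degree_mult_eq) auto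
  then have r: "r \<noteq> 0" "degree r = d" using r0 Suc.hyps(2) by auto
  define w' where "w' = X *\<^sub>v w + (- z) \<cdot>\<^sub>v w"
  have w': "w' \<in> S" unfolding w'_def using Suc.prems add smult inv by blast
  have Xw: "X *\<^sub>v w \<in> carrier_vec n" using X w by simp
  show ?case
  proof (cases "w' = 0\<^sub>v n")
    case True
    have "X *\<^sub>v w = z \<cdot>\<^sub>v w"
    proof (rule eq_vecI)
      fix a assume "a < dim_vec (z \<cdot>\<^sub>v w)"
      then have "a < n" "w' $ a = 0" using w True by auto
      then show "(X *\<^sub>v w) $ a = (z \<cdot>\<^sub>v w) $ a"
        using w Xw by (simp add: w'_def del: index_mult_mat_vec)
    qed (use w X in auto)
    then show ?thesis using Suc.prems by blast
  next
    case False
    have "(\<Sum>i\<le>degree r. coeff r i * (X ^\<^sub>m i *\<^sub>v w') $ a) = 0" if a: "a < n" for a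
    proof -
      define K where "K i = (X ^\<^sub>m i *\<^sub>v w) $ a" for i
      have K: "(X ^\<^sub>m i *\<^sub>v w') $ a = K (Suc i) - z * K i" for i
      proof -
        have P: "X ^\<^sub>m i \<in> carrier_mat n n" using X by simp
        have "X ^\<^sub>m i *\<^sub>v w' = X ^\<^sub>m i *\<^sub>v (X *\<^sub>v w) + (- z) \<cdot>\<^sub>v (X ^\<^sub>m i *\<^sub>v w)"
          unfolding w'_def mult_add_distrib_mat_vec[OF P Xw smult_carrier_vec[THEN iffD2, OF w]]
            mult_mat_vec[OF P w] ..
        moreover have "X ^\<^sub>m i *\<^sub>v (X *\<^sub>v w) = X ^\<^sub>m Suc i *\<^sub>v w"
          using assoc_mult_mat_vec[OF P X w] by simp
        ultimately show ?thesis
          using a w X by (simp add: K_def del: index_mult_mat_vec pow_mat.simps)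
      qed
      \<comment> \<open>With K i the chosen entry of X^i w, the coefficients of (x - z) r turn the
        relation for \<open>q\<close> and \<open>w\<close> into the relation for \<open>r\<close>
        and (X - z) w.\<close>
      have "0 = (\<Sum>i\<le>Suc d. coeff q i * K i)"
        using Suc.prems(4)[OF a] Suc.hyps(2) by (simp add: K_def)
      also have "\<dots> = coeff q 0 * K 0 + (\<Sum>i\<le>d. coeff q (Suc i) * K (Suc i))"
        by (rule sum.atMost_Suc_shift)
      also have "\<dots> = (\<Sum>i\<le>d. coeff r i * K (Suc i)) - z * (coeff r 0 * K 0 + (\<Sum>i\<le>d. coeff r (Suc i) * K (Suc i)))"
        by (simp add: q sum_subtractf sum_distrib_left algebra_simps)
      also have "coeff r 0 * K 0 + (\<Sum>i\<le>d. coeff r (Suc i) * K (Suc i)) = (\<Sum>i\<le>d. coeff r i * K i)"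
        using sum.atMost_Suc_shift[of "\<lambda>i. coeff r i * K i" d] r(2) by (simp add: coeff_eq_0)
      also have "(\<Sum>i\<le>d. coeff r i * K (Suc i)) - z * (\<Sum>i\<le>d. coeff r i * K i) =
          (\<Sum>i\<le>d. coeff r i * (K (Suc i) - z * K i))"
        by (simp add: sum_subtractf sum_distrib_left algebra_simps)
      finally show ?thesis by (simp add: K r(2))
    qed
    then show ?thesis
      using Suc.hyps(1)[of r w'] r w' False by blast
  qed
qed

text \<open>The n + 1 vectors w, Xw, ..., X^n w are linearly dependent, and the dependence is a
  nonzero polynomial annihilating \<open>w\<close>. Only closure properties of \<open>S\<close>
  enter, so no basis of \<open>S\<close> has to be chosen; taking for \<open>S\<close> an eigenspace
  of a matrix commuting with \<open>X\<close> gives common eigenvectors.\<close>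

lemma eigenvector_in_invariant_subspace:
  fixes X :: "complex mat"
  assumes X: "X \<in> carrier_mat n n" and S: "S \<subseteq> carrier_vec n"
    and add: "\<And>v w. v \<in> S \<Longrightarrow> w \<in> S \<Longrightarrow> v + w \<in> S"
    and smult: "\<And>c v. v \<in> S \<Longrightarrow> c \<cdot>\<^sub>v v \<in> S"
    and inv: "\<And>v. v \<in> S \<Longrightarrow> X *\<^sub>v v \<in> S"
    and w: "w \<in> S" "w \<noteq> 0\<^sub>v n"
  obtains u z where "u \<in> S" "u \<noteq> 0\<^sub>v n" "X *\<^sub>v u = z \<cdot>\<^sub>v u"
proof -
  have wc: "w \<in> carrier_vec n" using w S by auto
  obtain c where c: "\<exists>i\<le>n. c i \<noteq> 0"
      "\<And>a. a < n \<Longrightarrow> (\<Sum>i\<le>n. c i * (X ^\<^sub>m i *\<^sub>v w) $ a) = 0"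
    using linear_dependence_vec[of "\<lambda>i. X ^\<^sub>m i *\<^sub>v w" n] X wc
    by (metis mult_mat_vec_carrier pow_carrier_mat)
  define q where "q = (\<Sum>i\<le>n. monom (c i) i)"
  have coeff: "coeff q i = (if i \<le> n then c i else 0)" for i
    by (simp add: q_def coeff_sum coeff_monom)
  have "q \<noteq> 0" using c(1) coeff by (metis coeff_0)
  moreover have "(\<Sum>i\<le>degree q. coeff q i * (X ^\<^sub>m i *\<^sub>v w) $ a) = 0" if "a < n" for a
  proof -
    have "degree q \<le> n" by (rule degree_le) (simp add: coeff)
    then have "(\<Sum>i\<le>degree q. coeff q i * (X ^\<^sub>m i *\<^sub>v w) $ a) = (\<Sum>i\<le>n. coeff q i * (X ^\<^sub>m i *\<^sub>v w) $ a)"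
      by (intro sum.mono_neutral_left) (auto simp: coeff_eq_0)
    also have "\<dots> = 0" using c(2)[OF that] by (simp add: coeff)
    finally show ?thesis .
  qed
  ultimately show ?thesis
    using that eigenvector_in_annihilated_subspace[OF X S add smult inv, of q w] w by blast
qed

section \<open>The exponential acting on complex vectors\<close>

lemma cspectrum_iff:
  assumes "X \<in> carrier_mat n n"
  shows "z \<in> cspectrum X \<longleftrightarrow>
    (\<exists>u\<in>carrier_vec n. u \<noteq> 0\<^sub>v n \<and> map_mat complex_of_real X *\<^sub>v u = z \<cdot>\<^sub>v u)"
  using assms by (auto simp: cspectrum_def spectrum_def eigenvalue_def eigenvector_def)

lemma exp_mat_mult_vec_sums:
  assumes X: "X \<in> carrier_mat n n" and v: "v \<in> carrier_vec n" and i: "i < n"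
  shows "(\<lambda>l. (map_mat complex_of_real X ^\<^sub>m l *\<^sub>v v) $ i / fact l) sums
    (map_mat complex_of_real (exp_mat X) *\<^sub>v v) $ i"
proof -
  have "(\<lambda>l. \<Sum>r<n. complex_of_real ((X ^\<^sub>m l) $$ (i, r) / fact l) * v $ r) sums
      (\<Sum>r<n. complex_of_real (exp_mat X $$ (i, r)) * v $ r)"
    using X i by (intro sums_sum sums_mult2 sums_of_real exp_mat_sums) auto
  moreover have "(\<Sum>r<n. complex_of_real ((X ^\<^sub>m l) $$ (i, r) / fact l) * v $ r) =
      (map_mat complex_of_real X ^\<^sub>m l *\<^sub>v v) $ i / fact l" for l
    using index_mult_mat_vec_sum[of "map_mat complex_of_real X ^\<^sub>m l" n n v i] X v i
    by (simp add: of_real_hom.mat_hom_pow[OF X, symmetric] sum_divide_distrib del: index_mult_mat_vec)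
  moreover have "(map_mat complex_of_real (exp_mat X) *\<^sub>v v) $ i =
      (\<Sum>r<n. complex_of_real (exp_mat X $$ (i, r)) * v $ r)"
  proof -
    have "exp_mat X \<in> carrier_mat n n" using X by simp
    then show ?thesis
      using index_mult_mat_vec_sum[of "map_mat complex_of_real (exp_mat X)" n n v i] v i
      by (simp del: index_mult_mat_vec)
  qed
  ultimately show ?thesis by simp
qed

lemma pow_mat_eigenvector:
  fixes X :: "complex mat"
  assumes X: "X \<in> carrier_mat n n" and u: "u \<in> carrier_vec n" and eig: "X *\<^sub>v u = z \<cdot>\<^sub>v u"
  shows "X ^\<^sub>m l *\<^sub>v u = z ^ l \<cdot>\<^sub>v u"
proof (induction l)
  case (Suc l)
  have "X ^\<^sub>m Suc l *\<^sub>v u = X ^\<^sub>m l *\<^sub>v (z \<cdot>\<^sub>v u)"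
    using X u eig by (simp add: assoc_mult_mat_vec[of _ n n _ n])
  also have "\<dots> = z \<cdot>\<^sub>v (z ^ l \<cdot>\<^sub>v u)"
    using mult_mat_vec[of "X ^\<^sub>m l" n n u z] X u Suc by simp
  finally show ?case by (simp add: smult_smult_assoc)
qed (use X u in auto)

lemma exp_mat_eigenvector:
  assumes X: "X \<in> carrier_mat n n" and u: "u \<in> carrier_vec n"
    and eig: "map_mat complex_of_real X *\<^sub>v u = z \<cdot>\<^sub>v u"
  shows "map_mat complex_of_real (exp_mat X) *\<^sub>v u = exp z \<cdot>\<^sub>v u"
proof (rule eq_vecI)
  fix i assume "i < dim_vec (exp z \<cdot>\<^sub>v u)"
  then have i: "i < n" using u by simp
  have "(\<lambda>l. (z ^ l / fact l) * u $ i) sums (exp z * u $ i)"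
    using exp_converges[of z] by (intro sums_mult2) (simp add: scaleR_conv_of_real field_simps)
  moreover have "(\<lambda>l. (z ^ l / fact l) * u $ i) sums (map_mat complex_of_real (exp_mat X) *\<^sub>v u) $ i"
    using exp_mat_mult_vec_sums[OF X u i] pow_mat_eigenvector[OF _ u eig] X u i by simp
  ultimately show "(map_mat complex_of_real (exp_mat X) *\<^sub>v u) $ i = (exp z \<cdot>\<^sub>v u) $ i"
    using u i sums_unique2 by fastforce
qed (use X u in \<open>auto simp: exp_mat_def\<close>)

text \<open>All terms of the series from the second power on vanish at \<open>v\<close>. The
  condition concerns the single vector \<open>v\<close>; \<open>Z\<close> itself need not be
  nilpotent.\<close>

lemma exp_mat_square_zero:
  assumes Z: "Z \<in> carrier_mat n n" and v: "v \<in> carrier_vec n"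
    and zero: "map_mat complex_of_real Z *\<^sub>v (map_mat complex_of_real Z *\<^sub>v v) = 0\<^sub>v n"
  shows "map_mat complex_of_real (exp_mat Z) *\<^sub>v v = v + map_mat complex_of_real Z *\<^sub>v v"
proof (rule eq_vecI)
  let ?Z = "map_mat complex_of_real Z"
  have C: "?Z \<in> carrier_mat n n" using Z by simp
  fix i assume "i < dim_vec (v + ?Z *\<^sub>v v)"
  then have i: "i < n" using Z by simp
  have "?Z ^\<^sub>m Suc (Suc l) *\<^sub>v v = 0\<^sub>v n" for l
  proof -
    have P: "?Z ^\<^sub>m l \<in> carrier_mat n n" using C by simp
    have "?Z ^\<^sub>m l *\<^sub>v 0\<^sub>v n = 0\<^sub>v n" using P Z by (intro eq_vecI) auto
    moreover have "?Z ^\<^sub>m Suc (Suc l) *\<^sub>v v = ?Z ^\<^sub>m l *\<^sub>v (?Z *\<^sub>v (?Z *\<^sub>v v))"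
      unfolding pow_mat.simps assoc_mult_mat_vec[OF mult_carrier_mat[OF P C] C v]
        assoc_mult_mat_vec[OF P C mult_mat_vec_carrier[OF C v]] ..
    ultimately show ?thesis by (simp only: zero)
  qed
  then have "(?Z ^\<^sub>m l *\<^sub>v v) $ i / fact l = 0" if "l \<notin> {0, 1}" for l
    using that i by (cases l; cases "l - 1") (auto simp del: pow_mat.simps index_mult_mat_vec)
  then have "(\<lambda>l. (?Z ^\<^sub>m l *\<^sub>v v) $ i / fact l) sums (\<Sum>l\<in>{0, 1}. (?Z ^\<^sub>m l *\<^sub>v v) $ i / fact l)"
    by (intro sums_finite) auto
  also have "(\<Sum>l\<in>{0, 1}. (?Z ^\<^sub>m l *\<^sub>v v) $ i / fact l) = (v + ?Z *\<^sub>v v) $ i"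
    using C v i Z by (simp del: index_mult_mat_vec)
  finally show "(map_mat complex_of_real (exp_mat Z) *\<^sub>v v) $ i = (v + ?Z *\<^sub>v v) $ i"
    using exp_mat_mult_vec_sums[OF Z v i] sums_unique2 by blast
qed (use Z v in \<open>auto simp: exp_mat_def\<close>)

section \<open>Injectivity of the exponential on the strip\<close>

lemma smult_vec_cancel:
  fixes u :: "'a :: field vec"
  assumes "u \<in> carrier_vec n" "u \<noteq> 0\<^sub>v n" "a \<cdot>\<^sub>v u = b \<cdot>\<^sub>v u"
  shows "a = b"
proof -
  obtain i where i: "i < n" "u $ i \<noteq> 0"
    using assms(1,2) by (metis carrier_vecD eq_vecI index_zero_vec(1) index_zero_vec(2))
  have "(a \<cdot>\<^sub>v u) $ i = (b \<cdot>\<^sub>v u) $ i" using assms(3) by simp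
  then show ?thesis using i assms(1) by simp
qed

text \<open>The modulus gives real part 0, and then cos (Im a) = 1 makes Im a an integer multiple of
  2 pi. The bound \<open>2 * pi\<close> is the width of the logarithm strip, which is what a
  difference of two of its points satisfies.\<close>

lemma exp_eq_1_in_strip:
  fixes a :: complex
  assumes "exp a = 1" and "\<bar>Im a\<bar> < 2 * pi"
  shows "a = 0"
proof -
  have "norm (exp a) = 1" using assms by simp
  then have re: "Re a = 0" by simp
  then have "cos (Im a) = 1" using assms(1) by (simp add: complex_eq_iff Re_exp)
  then have "cos \<bar>Im a\<bar> = 1" by simp
  then obtain m :: int where m: "\<bar>Im a\<bar> = of_int m * 2 * pi"
    using cos_one_2pi_int by blast
  then have r: "real_of_int m = \<bar>Im a\<bar> / (2 * pi)" by simp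
  have "real_of_int m < 1" "0 \<le> real_of_int m"
    unfolding r using assms(2) by (simp_all add: divide_less_eq)
  then have "m = 0" by linarith
  then have "Im a = 0" using m by simp
  then show ?thesis using re by (simp add: complex_eq_iff)
qed

lemma exp_mat_inject_strip:
  assumes X: "X \<in> carrier_mat n n" and Y: "Y \<in> carrier_mat n n" and XY: "X * Y = Y * X"
    and E: "exp_mat X = exp_mat Y"
    and sX: "\<forall>z\<in>cspectrum X. - pi < Im z \<and> Im z < pi"
    and sY: "\<forall>z\<in>cspectrum Y. - pi < Im z \<and> Im z < pi"
  shows "X = Y"
proof (rule ccontr)
  assume "X \<noteq> Y"
  define Z where "Z = X - Y"
  define cX where "cX = map_mat complex_of_real X"
  define cY where "cY = map_mat complex_of_real Y"
  define cZ where "cZ = map_mat complex_of_real Z"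
  have Z: "Z \<in> carrier_mat n n" using X Y by (simp add: Z_def minus_carrier_mat)
  have cX: "cX \<in> carrier_mat n n" and cY: "cY \<in> carrier_mat n n" and cZ: "cZ \<in> carrier_mat n n"
    using X Y Z by (auto simp: cX_def cY_def cZ_def)
  have "exp_mat Z = exp_mat (X + - Y)"
    using X Y by (intro arg_cong[of _ _ exp_mat] eq_matI) (auto simp: Z_def)
  also have "\<dots> = exp_mat X * exp_mat (- Y)"
    using X Y XY by (intro exp_mat_add) auto
  also have "\<dots> = 1\<^sub>m n" unfolding E by (rule exp_mat_uminus_right[OF Y])
  finally have expZ: "map_mat complex_of_real (exp_mat Z) = 1\<^sub>m n"
    by (simp add: of_real_hom.mat_hom_one)
  have cZ_eq: "cZ = cX - cY" unfolding cX_def cY_def cZ_def Z_def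
    using X Y by (intro eq_matI) auto
  have cXY: "cX * cY = cY * cX"
    using of_real_hom.mat_hom_mult[OF X Y, where ?'a = complex]
      of_real_hom.mat_hom_mult[OF Y X, where ?'a = complex] XY
    by (simp add: cX_def cY_def)
  have cXZ: "cX * cZ = cZ * cX" and cYZ: "cY * cZ = cZ * cY"
    unfolding cZ_eq mult_minus_distrib_mat[OF cX cX cY] mult_minus_distrib_mat[OF cY cX cY]
      minus_mult_distrib_mat[OF cX cY cX] minus_mult_distrib_mat[OF cX cY cY] cXY by (rule refl)+
  \<comment> \<open>A common eigenvector of \<open>X\<close> and \<open>Y\<close> in the range of \<open>Z\<close> is killed by \<open>Z\<close>, because
    \<open>exp Z = 1\<close>; on a preimage \<open>v\<close> of it the exponential series of \<open>Z\<close> stops at \<open>v + Z v\<close>.\<close>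
  define S where "S = (\<lambda>v. cZ *\<^sub>v v) ` carrier_vec n"
  have S: "S \<subseteq> carrier_vec n" using cZ by (auto simp: S_def)
  have add: "v + w \<in> S" if vw: "v \<in> S" "w \<in> S" for v w
  proof -
    obtain a where a: "a \<in> carrier_vec n" "v = cZ *\<^sub>v a" using vw(1) by (auto simp: S_def)
    obtain b where b: "b \<in> carrier_vec n" "w = cZ *\<^sub>v b" using vw(2) by (auto simp: S_def)
    show ?thesis
      unfolding S_def a(2) b(2) mult_add_distrib_mat_vec[OF cZ a(1) b(1), symmetric]
      using a b by (intro imageI add_carrier_vec)
  qed
  have smult: "c \<cdot>\<^sub>v v \<in> S" if v: "v \<in> S" for c v
  proof -
    obtain a where a: "a \<in> carrier_vec n" "v = cZ *\<^sub>v a" using v by (auto simp: S_def)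
    show ?thesis
      unfolding S_def a(2) mult_mat_vec[OF cZ a(1), symmetric] using a by (intro imageI) simp
  qed
  \<comment> \<open>The range of Z is mapped into itself by anything that commutes with Z, since M
    (Z u) = Z (M u). This serves both X and Y.\<close>
  have inv: "M *\<^sub>v v \<in> S" if M: "M \<in> carrier_mat n n" "M * cZ = cZ * M" and v: "v \<in> S" for M v
  proof -
    obtain u where u: "u \<in> carrier_vec n" "v = cZ *\<^sub>v u" using v by (auto simp: S_def)
    then have "M *\<^sub>v v = cZ *\<^sub>v (M *\<^sub>v u)"
      using assoc_mult_mat_vec[OF M(1) cZ u(1)] assoc_mult_mat_vec[OF cZ M(1) u(1)] M(2) by simp
    then show ?thesis using M u by (auto simp: S_def)
  qed
  obtain i j where ij: "i < n" "j < n" "Z $$ (i, j) \<noteq> 0"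
  proof -
    have "\<exists>i<n. \<exists>j<n. X $$ (i, j) \<noteq> Y $$ (i, j)"
    proof (rule ccontr)
      assume "\<not> ?thesis"
      then have "X = Y" using X Y by (intro eq_matI) auto
      then show False using \<open>X \<noteq> Y\<close> by simp
    qed
    then obtain i j where "i < n" "j < n" "X $$ (i, j) \<noteq> Y $$ (i, j)" by blast
    then show ?thesis using that[of i j] X Y by (simp add: Z_def)
  qed
  \<comment> \<open>The \<open>j\<close>-th column of Z: a vector of the range that is nonzero
    because it contains the entry where X and Y differ.\<close>
  define w where "w = cZ *\<^sub>v unit_vec n j"
  have "w $ i = complex_of_real (Z $$ (i, j))"
    using ij Z cZ by (simp add: w_def cZ_def)
  then have w: "w \<in> S" "w \<noteq> 0\<^sub>v n" using ij by (auto simp: w_def S_def)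
  obtain u z where u: "u \<in> S" "u \<noteq> 0\<^sub>v n" "cX *\<^sub>v u = z \<cdot>\<^sub>v u"
    using eigenvector_in_invariant_subspace[OF cX S add smult inv[OF cX cXZ] w] by blast
  \<comment> \<open>An eigenspace of X within the range of Z. It is stable under Y by commutation,
    so an eigenvector of Y found in it is a common one.\<close>
  define T where "T = {v \<in> S. cX *\<^sub>v v = z \<cdot>\<^sub>v v}"
  have T: "T \<subseteq> carrier_vec n" using S by (auto simp: T_def)
  have T_add: "v + w \<in> T" if "v \<in> T" "w \<in> T" for v w
  proof -
    have "v \<in> carrier_vec n" "w \<in> carrier_vec n" using that T by auto
    then show ?thesis
      using that add by (simp add: T_def mult_add_distrib_mat_vec[OF cX] smult_add_distrib_vec)
  qed
  have T_smult: "c \<cdot>\<^sub>v v \<in> T" if "v \<in> T" for c v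
  proof -
    have "v \<in> carrier_vec n" using that T by auto
    then show ?thesis
      using that smult by (simp add: T_def mult_mat_vec[OF cX] smult_smult_assoc mult.commute)
  qed
  have T_inv: "cY *\<^sub>v v \<in> T" if "v \<in> T" for v
  proof -
    have v: "v \<in> carrier_vec n" using that T by auto
    have "cX *\<^sub>v (cY *\<^sub>v v) = cY *\<^sub>v (cX *\<^sub>v v)"
      using assoc_mult_mat_vec[OF cX cY v] assoc_mult_mat_vec[OF cY cX v] cXY by simp
    then show ?thesis
      using that inv[OF cY cYZ] v by (simp add: T_def mult_mat_vec[OF cY])
  qed
  have uT: "u \<in> T" using u by (simp add: T_def)
  obtain x y where x: "x \<in> T" "x \<noteq> 0\<^sub>v n" "cY *\<^sub>v x = y \<cdot>\<^sub>v x"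
    using eigenvector_in_invariant_subspace[OF cY T T_add T_smult T_inv uT u(2)] by blast
  have xc: "x \<in> carrier_vec n" and Xx: "cX *\<^sub>v x = z \<cdot>\<^sub>v x" using x T by (auto simp: T_def)
  have Zx: "cZ *\<^sub>v x = (z - y) \<cdot>\<^sub>v x"
    unfolding cZ_eq minus_mult_distrib_mat_vec[OF cX cY xc] Xx x(3)
    using xc by (intro eq_vecI) (auto simp: algebra_simps)
  have "exp (z - y) \<cdot>\<^sub>v x = 1 \<cdot>\<^sub>v x"
    using exp_mat_eigenvector[OF Z xc Zx[unfolded cZ_def]] xc by (simp add: expZ)
  then have "exp (z - y) = 1" by (rule smult_vec_cancel[OF xc x(2)])
  moreover have "z \<in> cspectrum X" "y \<in> cspectrum Y"
    using cspectrum_iff[OF X] cspectrum_iff[OF Y] xc x Xx by (auto simp: cX_def cY_def)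
  then have "- pi < Im z \<and> Im z < pi" "- pi < Im y \<and> Im y < pi" using sX sY by blast+
  then have "\<bar>Im (z - y)\<bar> < 2 * pi" by auto
  ultimately have "z - y = 0" by (rule exp_eq_1_in_strip)
  then have Zx0: "cZ *\<^sub>v x = 0\<^sub>v n" using Zx xc by (auto intro!: eq_vecI)
  obtain v where v: "v \<in> carrier_vec n" "x = cZ *\<^sub>v v" using x by (auto simp: T_def S_def)
  have "1\<^sub>m n *\<^sub>v v = v + x"
    using exp_mat_square_zero[OF Z v(1)] Zx0 unfolding expZ v(2) cZ_def by simp
  then have vx: "v + x = v" using v(1) by simp
  have "x $ i = 0" if "i < n" for i
    using arg_cong[OF vx, of "\<lambda>v. v $ i"] that xc by simp
  then have "x = 0\<^sub>v n" using xc by (intro eq_vecI) auto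
  then show False using x by simp
qed

section \<open>Polynomials in a matrix\<close>

lemma mat_power_sum_carrier [simp]:
  "X \<in> carrier_mat n n \<Longrightarrow> mat_power_sum c m X \<in> carrier_mat n n"
  by (auto simp: mat_power_sum_def)

lemma mat_power_sum_index:
  "X \<in> carrier_mat n n \<Longrightarrow> i < n \<Longrightarrow> j < n \<Longrightarrow>
    mat_power_sum c m X $$ (i, j) = (\<Sum>l<m. c l * (X ^\<^sub>m l) $$ (i, j))"
  by (auto simp: mat_power_sum_def)

lemma mat_power_sum_0: "X \<in> carrier_mat n n \<Longrightarrow> mat_power_sum c 0 X = 0\<^sub>m n n"
  by (intro eq_matI) (auto simp: mat_power_sum_def)

lemma mat_power_sum_Suc:
  assumes "X \<in> carrier_mat n n"
  shows "mat_power_sum c (Suc m) X = mat_power_sum c m X + c m \<cdot>\<^sub>m X ^\<^sub>m m"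
  using assms by (intro eq_matI) (auto simp: mat_power_sum_def split: if_splits)

lemma mat_power_sum_uminus:
  assumes "X \<in> carrier_mat n n"
  shows "mat_power_sum (\<lambda>l. - c l) m X = - mat_power_sum c m X"
  using assms by (intro eq_matI) (auto simp: mat_power_sum_def sum_negf)

lemma mat_power_sum_commute:
  assumes X: "X \<in> carrier_mat n n" and Y: "Y \<in> carrier_mat n n" and XY: "X * Y = Y * X"
  shows "mat_power_sum c m X * Y = Y * mat_power_sum c m X"
proof (induction m)
  case 0
  show ?case using X Y by (simp add: mat_power_sum_0)
next
  case (Suc m)
  have P: "mat_power_sum c m X \<in> carrier_mat n n" "c m \<cdot>\<^sub>m X ^\<^sub>m m \<in> carrier_mat n n"
    "X ^\<^sub>m m \<in> carrier_mat n n" using X by auto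
  show ?case
    unfolding mat_power_sum_Suc[OF X] add_mult_distrib_mat[OF P(1,2) Y]
      mult_add_distrib_mat[OF Y P(1,2)] Suc mult_smult_assoc_mat[OF P(3) Y]
      mult_smult_distrib[OF Y P(3)] pow_mat_commute[OF X Y XY] ..
qed

lemma mult_mat_power_sum_index:
  assumes X: "X \<in> carrier_mat n n" and ij: "i < n" "j < n"
  shows "(X * mat_power_sum c m X) $$ (i, j) = (\<Sum>l<m. c l * (X ^\<^sub>m Suc l) $$ (i, j))"
proof -
  have P: "mat_power_sum c m X \<in> carrier_mat n n" using X by simp
  have "(X ^\<^sub>m Suc l) $$ (i, j) = (\<Sum>r<n. X $$ (i, r) * (X ^\<^sub>m l) $$ (r, j))" for l
    using index_mult_mat_sum[of X n n "X ^\<^sub>m l" n i j] X ij pow_mat_commute[OF X X refl, of l] by simp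
  moreover have "(X * mat_power_sum c m X) $$ (i, j) =
      (\<Sum>r<n. \<Sum>l<m. X $$ (i, r) * (c l * (X ^\<^sub>m l) $$ (r, j)))"
    unfolding index_mult_mat_sum[OF X P ij] using X ij
    by (simp add: mat_power_sum_index sum_distrib_left)
  ultimately show ?thesis
    by (subst (asm) sum.swap) (simp add: sum_distrib_left mult_ac del: pow_mat.simps)
qed

lemma mat_power_sum_eigenvector:
  assumes X: "X \<in> carrier_mat n n" and u: "u \<in> carrier_vec n"
    and eig: "map_mat complex_of_real X *\<^sub>v u = z \<cdot>\<^sub>v u"
  shows "map_mat complex_of_real (mat_power_sum c m X) *\<^sub>v u = (\<Sum>l<m. of_real (c l) * z ^ l) \<cdot>\<^sub>v u"
proof (rule eq_vecI)
  fix i assume "i < dim_vec ((\<Sum>l<m. of_real (c l) * z ^ l) \<cdot>\<^sub>v u)"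
  then have i: "i < n" using u by simp
  let ?C = "map_mat complex_of_real"
  have P: "?C X ^\<^sub>m l \<in> carrier_mat n n" for l using X by simp
  have "z ^ l * u $ i = (\<Sum>r<n. complex_of_real ((X ^\<^sub>m l) $$ (i, r)) * u $ r)" for l
  proof -
    have "(?C X ^\<^sub>m l *\<^sub>v u) $ i = z ^ l * u $ i"
      using pow_mat_eigenvector[OF _ u eig, of l] X u i by (simp del: index_mult_mat_vec)
    then show ?thesis
      using index_mult_mat_vec_sum[OF P[of l] u i] X i
      by (simp add: of_real_hom.mat_hom_pow[OF X, symmetric] del: index_mult_mat_vec)
  qed
  moreover have "(?C (mat_power_sum c m X) *\<^sub>v u) $ i =
      (\<Sum>r<n. \<Sum>l<m. of_real (c l) * (complex_of_real ((X ^\<^sub>m l) $$ (i, r)) * u $ r))"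
    using index_mult_mat_vec_sum[of "?C (mat_power_sum c m X)" n n u i] X u i
    by (simp add: carrier_matD[OF mat_power_sum_carrier[OF X]] mat_power_sum_index
        sum_distrib_right mult.assoc del: index_mult_mat_vec)
  ultimately show "(?C (mat_power_sum c m X) *\<^sub>v u) $ i = ((\<Sum>l<m. of_real (c l) * z ^ l) \<cdot>\<^sub>v u) $ i"
    using u i by (subst (asm) sum.swap) (simp add: sum_distrib_left sum_distrib_right mult.assoc)
qed (use X u in \<open>auto simp: mat_power_sum_def\<close>)

section \<open>The differential equation\<close>

text \<open>Taking a filter rather than a point allows derivatives within D, the only ones that the
  initial value problem provides.\<close>

definition has_mat_derivative ::
    "nat \<Rightarrow> (real \<Rightarrow> real mat) \<Rightarrow> real mat \<Rightarrow> real filter \<Rightarrow> bool" where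
  "has_mat_derivative n F F' G \<longleftrightarrow>
    (\<forall>i<n. \<forall>j<n. ((\<lambda>s. F s $$ (i, j)) has_field_derivative F' $$ (i, j)) G)"

lemma has_mat_derivative_mult:
  assumes F: "\<And>s. F s \<in> carrier_mat n n" "F' \<in> carrier_mat n n"
    and G: "\<And>s. G s \<in> carrier_mat n n" "G' \<in> carrier_mat n n"
    and "has_mat_derivative n F F' (at t within D)" "has_mat_derivative n G G' (at t within D)"
  shows "has_mat_derivative n (\<lambda>s. F s * G s) (F' * G t + F t * G') (at t within D)"
  unfolding has_mat_derivative_def
proof (intro allI impI)
  fix i j assume ij: "i < n" "j < n"
  have "((\<lambda>s. \<Sum>r<n. F s $$ (i, r) * G s $$ (r, j)) has_field_derivative
      (\<Sum>r<n. F' $$ (i, r) * G t $$ (r, j) + G' $$ (r, j) * F t $$ (i, r))) (at t within D)"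
    using assms(5,6) ij unfolding has_mat_derivative_def by (intro DERIV_sum DERIV_mult) auto
  moreover have "(F' * G t + F t * G') $$ (i, j) = (F' * G t) $$ (i, j) + (F t * G') $$ (i, j)"
    using F(1)[of t] F(2) G(1)[of t] G(2) ij by simp
  ultimately show "((\<lambda>s. (F s * G s) $$ (i, j)) has_field_derivative (F' * G t + F t * G') $$ (i, j))
      (at t within D)"
    by (simp add: index_mult_mat_sum[OF F(1) G(1) ij] index_mult_mat_sum[OF F(2) G(1) ij]
        index_mult_mat_sum[OF F(1) G(2) ij] sum.distrib mult.commute)
qed

text \<open>For a general curve of matrices the derivative of the exponential is not X' exp X. Here
  all values are polynomials in one matrix and commute, so the exponential splits into the factors
  exp(g_l(s) X^l); these are added one at a time by the product rule, each being differentiated by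
  the scalar chain rule.\<close>

lemma exp_mat_power_sum_derivative:
  assumes X: "X \<in> carrier_mat n n"
    and g: "\<And>l. l < m \<Longrightarrow> (g l has_field_derivative g' l) (at t within D)"
  shows "has_mat_derivative n (\<lambda>s. exp_mat (mat_power_sum (\<lambda>l. g l s) m X))
    (mat_power_sum g' m X * exp_mat (mat_power_sum (\<lambda>l. g l t) m X)) (at t within D)"
  using g
proof (induction m)
  case 0
  then show ?case using X by (simp add: has_mat_derivative_def mat_power_sum_0 exp_mat_zero)
next
  case (Suc m)
  let ?S = "\<lambda>s. mat_power_sum (\<lambda>l. g l s) m X" and ?P = "X ^\<^sub>m m" and ?V = "mat_power_sum g' m X"
  have P: "?P \<in> carrier_mat n n" and S: "?S s \<in> carrier_mat n n" and V: "?V \<in> carrier_mat n n" for s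
    using X by auto
  have SP: "?S s * ?P = ?P * ?S s" for s
    using X P by (intro mat_power_sum_commute pow_mat_commute[symmetric]) auto
  define F where "F s = exp_mat (?S s)" for s
  define G where "G s = exp_mat (g m s \<cdot>\<^sub>m ?P)" for s
  have F: "F s \<in> carrier_mat n n" and G: "G s \<in> carrier_mat n n" for s
    using X unfolding F_def G_def by auto
  have FG: "exp_mat (mat_power_sum (\<lambda>l. g l s) (Suc m) X) = F s * G s" for s
    unfolding mat_power_sum_Suc[OF X] F_def G_def
    using S P SP[of s] mult_smult_distrib[OF S[of s] P] mult_smult_assoc_mat[OF P S[of s]]
    by (intro exp_mat_add) auto
  have dF: "has_mat_derivative n F (?V * F t) (at t within D)"
    using Suc unfolding F_def by simp
  have dG: "has_mat_derivative n G (g' m \<cdot>\<^sub>m (?P * G t)) (at t within D)"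
    unfolding has_mat_derivative_def
  proof (intro allI impI)
    fix i j assume ij: "i < n" "j < n"
    have "((\<lambda>s. exp_mat (g m s \<cdot>\<^sub>m ?P) $$ (i, j)) has_field_derivative
        (?P * exp_mat (g m t \<cdot>\<^sub>m ?P)) $$ (i, j) * g' m) (at t within D)"
      using DERIV_chain2[OF exp_mat_smult_deriv[OF P ij] Suc.prems] by simp
    moreover have "(g' m \<cdot>\<^sub>m (?P * G t)) $$ (i, j) = (?P * G t) $$ (i, j) * g' m"
      using mult_carrier_mat[OF P G[of t]] ij by (metis carrier_matD index_smult_mat(1) mult.commute)
    ultimately show "((\<lambda>s. G s $$ (i, j)) has_field_derivative (g' m \<cdot>\<^sub>m (?P * G t)) $$ (i, j)) (at t within D)"
      by (simp only: G_def)
  qed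
  have "?V * F t * G t + F t * (g' m \<cdot>\<^sub>m (?P * G t)) = (?V + g' m \<cdot>\<^sub>m ?P) * (F t * G t)"
  proof -
    have "F t * (g' m \<cdot>\<^sub>m (?P * G t)) = g' m \<cdot>\<^sub>m (F t * ?P * G t)"
      using mult_smult_distrib[OF F mult_carrier_mat[OF P G]] assoc_mult_mat[OF F P G] by simp
    also have "F t * ?P = ?P * F t" unfolding F_def by (rule exp_mat_commute[OF S P SP])
    also have "g' m \<cdot>\<^sub>m (?P * F t * G t) = (g' m \<cdot>\<^sub>m ?P) * (F t * G t)"
      using mult_smult_assoc_mat[OF P mult_carrier_mat[OF F G]] assoc_mult_mat[OF P F G] by simp
    finally show ?thesis
      using assoc_mult_mat[OF V F G]
        add_mult_distrib_mat[OF V smult_carrier_mat[OF P] mult_carrier_mat[OF F G]] by simp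
  qed
  then show ?case
    unfolding FG mat_power_sum_Suc[OF X, of g']
    using has_mat_derivative_mult[OF F mult_carrier_mat[OF V F] G _ dF dG] P G
    by simp
qed

text \<open>The derivative is only taken within \<open>D\<close>, but strictly between two points of
  the interval it is two-sided, and at the end points continuity suffices for the mean value
  theorem.\<close>

lemma has_real_derivative_zero_constant_interval:
  fixes f :: "real \<Rightarrow> real"
  assumes D: "\<And>x y z. x \<in> D \<Longrightarrow> y \<in> D \<Longrightarrow> x \<le> z \<Longrightarrow> z \<le> y \<Longrightarrow> z \<in> D"
    and f: "\<And>x. x \<in> D \<Longrightarrow> (f has_field_derivative 0) (at x within D)"
    and "a \<in> D" "b \<in> D"
  shows "f a = f b"
proof -
  have *: "f b = f a" if ab: "a \<in> D" "b \<in> D" "a < b" for a b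
  proof (rule DERIV_isconst_end[OF ab(3)])
    have sub: "{a..b} \<subseteq> D" using D[OF ab(1,2)] by auto
    show "continuous_on {a..b} f"
      using f by (intro continuous_on_subset[OF _ sub] DERIV_continuous_on)
    show "DERIV f x :> 0" if x: "a < x" "x < b" for x
    proof -
      have "(f has_field_derivative 0) (at x within {a<..<b})"
        using x sub by (intro DERIV_subset[OF f]) auto
      then show ?thesis using x by (simp add: at_within_open[of x "{a<..<b}"])
    qed
  qed
  show ?thesis using *[of a b] *[of b a] assms(3,4) by (cases a b rule: linorder_cases) auto
qed

section \<open>From the companion system to an equation for matrices\<close>

lemma mult_minus_one_smult:
  assumes X: "X \<in> carrier_mat n n" and N: "N \<in> carrier_mat n n"
  shows "X * (1\<^sub>m n - t \<cdot>\<^sub>m N) = X - t \<cdot>\<^sub>m (X * (N :: real mat))"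
    and "(1\<^sub>m n - t \<cdot>\<^sub>m N) * X = X - t \<cdot>\<^sub>m (N * X)"
  unfolding mult_minus_distrib_mat[OF X one_carrier_mat smult_carrier_mat[OF N]]
    minus_mult_distrib_mat[OF one_carrier_mat smult_carrier_mat[OF N] X]
    mult_smult_distrib[OF X N] mult_smult_assoc_mat[OF N X]
    right_mult_one_mat[OF X] left_mult_one_mat[OF X] by (rule refl)+

text \<open>If \<open>v\<close> lists the coefficients of a polynomial of degree at most
  \<open>m\<close>, then C v lists those of its product with the variable, reduced modulo
  \<open>p\<close>: all coefficients move up by one, and the leading one returns as
  -\<open>coeff p i\<close> times \<open>v $ m\<close>.\<close>

lemma companion_row:
  assumes k: "degree p = Suc m" and v: "v \<in> carrier_vec (Suc m)" and i: "i < Suc m"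
  shows "((1\<^sub>m (Suc m) - t \<cdot>\<^sub>m companion_mat p) *\<^sub>v v) $ i =
    v $ i - t * ((if i = 0 then 0 else v $ (i - 1)) - coeff p i * v $ m)"
proof -
  have C: "companion_mat p \<in> carrier_mat (Suc m) (Suc m)" by (simp add: companion_mat_def k)
  have "((1\<^sub>m (Suc m) - t \<cdot>\<^sub>m companion_mat p) *\<^sub>v v) $ i =
      (\<Sum>r<Suc m. (if r = i then v $ r else 0) - t * (companion_mat p $$ (i, r) * v $ r))"
  proof (subst index_mult_mat_vec_sum[of _ "Suc m" "Suc m"], goal_cases)
    case 4
    have "(1\<^sub>m (Suc m) - t \<cdot>\<^sub>m companion_mat p) $$ (i, r) =
        (if r = i then 1 else 0) - t * companion_mat p $$ (i, r)" if "r < Suc m" for r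
      using C i that by auto
    then show ?case by (intro sum.cong refl) (auto simp: left_diff_distrib)
  qed (use C v i in \<open>auto simp: minus_carrier_mat\<close>)
  also have "\<dots> = v $ i - t * (\<Sum>r<Suc m. companion_mat p $$ (i, r) * v $ r)"
    using i by (simp add: sum_subtractf sum_distrib_left del: sum.lessThan_Suc)
  also have "(\<Sum>r<Suc m. companion_mat p $$ (i, r) * v $ r) =
      (\<Sum>r<m. if Suc r = i then v $ r else 0) - coeff p i * v $ m"
    using i by (auto simp: companion_mat_def k intro!: sum.cong)
  also have "(\<Sum>r<m. if Suc r = i then v $ r else 0) = (if i = 0 then 0 else v $ (i - 1))"
    using i by (cases i) auto
  finally show ?thesis .
qed

text \<open>The passage goes from coefficients to matrices only: the powers of \<open>N\<close>
  below \<open>k\<close> may be linearly dependent, so an identity between matrices would not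
  determine the coefficients.\<close>

lemma companion_ode_annihilated:
  fixes N :: "real mat"
  assumes N: "N \<in> carrier_mat n n" and k: "degree p = k" "k \<ge> 2" and monic: "lead_coeff p = 1"
    and pN: "poly_mat p N = 0\<^sub>m n n"
    and v: "v \<in> carrier_vec k"
    and ode: "(1\<^sub>m k - t \<cdot>\<^sub>m companion_mat p) *\<^sub>v v = - unit_vec k 1"
  shows "(1\<^sub>m n - t \<cdot>\<^sub>m N) * mat_power_sum (\<lambda>l. v $ l) k N = - N"
proof (rule eq_matI)
  let ?W = "mat_power_sum (\<lambda>l. v $ l) k N"
  have W: "?W \<in> carrier_mat n n" using N by simp
  obtain m where m: "k = Suc m" using k by (cases k) auto
  fix a b assume "a < dim_row (- N)" "b < dim_col (- N)"
  then have ab: "a < n" "b < n" using N by auto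
  define P where "P l = (N ^\<^sub>m l) $$ (a, b)" for l
  have "(\<Sum>l<Suc k. coeff p l * P l) = poly_mat p N $$ (a, b)"
    unfolding poly_mat_def k(1) P_def by (rule mat_power_sum_index[OF N ab, symmetric])
  then have Pk: "P k = - (\<Sum>l<k. coeff p l * P l)"
    using pN ab monic k(1) by simp
  \<comment> \<open>The system row by row. Indices start at 0, so \<open>unit_vec k 1\<close> is e_2
    and stands for the first power of \<open>N\<close>.\<close>
  have row: "v $ i - t * ((if i = 0 then 0 else v $ (i - 1)) - coeff p i * v $ m) = (if i = 1 then - 1 else 0)"
    if "i < k" for i
  proof -
    have "(- unit_vec k 1 :: real vec) $ i = (if i = 1 then - 1 else 0)"
      using that k by (simp add: unit_vec_def)
    moreover have "((1\<^sub>m k - t \<cdot>\<^sub>m companion_mat p) *\<^sub>v v) $ i =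
        v $ i - t * ((if i = 0 then 0 else v $ (i - 1)) - coeff p i * v $ m)"
      using companion_row[of p m v i t] k(1) v that unfolding m by blast
    ultimately show ?thesis by (simp only: ode)
  qed
  have "((1\<^sub>m n - t \<cdot>\<^sub>m N) * ?W) $$ (a, b) = ?W $$ (a, b) - t * (N * ?W) $$ (a, b)"
    unfolding mult_minus_one_smult(2)[OF W N] using N ab by (simp add: carrier_matD[OF W])
  also have "\<dots> = (\<Sum>l<k. v $ l * P l) - t * (\<Sum>l<k. v $ l * P (Suc l))"
    using N ab by (simp only: mat_power_sum_index mult_mat_power_sum_index P_def)
  also have "(\<Sum>l<k. v $ l * P (Suc l)) = (\<Sum>l<m. v $ l * P (Suc l)) + v $ m * P k"
    by (simp add: m)
  \<comment> \<open>Raising all exponents by one leaves no constant term; the value 0 at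
    \<open>l = 0\<close> matches the first row of the companion matrix.\<close>
  also have "(\<Sum>l<m. v $ l * P (Suc l)) = (\<Sum>l<k. (if l = 0 then 0 else v $ (l - 1)) * P l)"
    unfolding m by (subst sum.lessThan_Suc_shift) simp
  also have "(\<Sum>l<k. v $ l * P l) - t * ((\<Sum>l<k. (if l = 0 then 0 else v $ (l - 1)) * P l) + v $ m * P k) =
      (\<Sum>l<k. (v $ l - t * ((if l = 0 then 0 else v $ (l - 1)) - coeff p l * v $ m)) * P l)"
    unfolding Pk by (simp add: sum_distrib_left sum_subtractf[symmetric] sum.distrib[symmetric] algebra_simps)
  also have "\<dots> = (\<Sum>l<k. if l = 1 then - P l else 0)"
    by (intro sum.cong) (auto simp: row)
  also have "\<dots> = - P 1" using k(2) by simp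
  finally show "((1\<^sub>m n - t \<cdot>\<^sub>m N) * ?W) $$ (a, b) = (- N) $$ (a, b)"
    using N ab by (simp add: P_def)
qed (use N in \<open>auto simp: mat_power_sum_def\<close>)

text \<open>With F = exp(-X) and L = I - tN, the derivative of F L is -X' F L - F N. By commutation
  X' occurs in it only through X' L = -N, which the equation prescribes, so the two terms cancel
  even though X' is never isolated. The constant value is I, and multiplying by exp X on the left
  frees L.\<close>

lemma exp_mat_of_log_ode:
  fixes N :: "real mat"
  assumes N: "N \<in> carrier_mat n n"
    and D: "\<And>x y z. x \<in> D \<Longrightarrow> y \<in> D \<Longrightarrow> x \<le> z \<Longrightarrow> z \<le> y \<Longrightarrow> z \<in> D" "0 \<in> D"
    and g: "\<And>t l. t \<in> D \<Longrightarrow> l < k \<Longrightarrow> (g l has_field_derivative g' t l) (at t within D)"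
    and ode: "\<And>t. t \<in> D \<Longrightarrow> (1\<^sub>m n - t \<cdot>\<^sub>m N) * mat_power_sum (g' t) k N = - N"
    and init: "\<And>l. l < k \<Longrightarrow> g l 0 = 0"
    and t: "t \<in> D"
  shows "exp_mat (mat_power_sum (\<lambda>l. g l t) k N) = 1\<^sub>m n - t \<cdot>\<^sub>m N"
proof -
  let ?X = "\<lambda>s. mat_power_sum (\<lambda>l. g l s) k N" and ?L = "\<lambda>s. 1\<^sub>m n - s \<cdot>\<^sub>m N"
  define F where "F s = exp_mat (mat_power_sum (\<lambda>l. - g l s) k N)" for s
  have X: "?X s \<in> carrier_mat n n" and F: "F s \<in> carrier_mat n n" and L: "?L s \<in> carrier_mat n n"
    for s using N by (auto simp: F_def minus_carrier_mat)
  have F_eq: "F s = exp_mat (- ?X s)" for s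
    by (simp add: F_def mat_power_sum_uminus[OF N])
  have const: "has_mat_derivative n (\<lambda>s. F s * ?L s) (0\<^sub>m n n) (at s within D)" if s: "s \<in> D" for s
  proof -
    let ?V = "mat_power_sum (g' s) k N"
    have V: "?V \<in> carrier_mat n n" using N by simp
    have "has_mat_derivative n F (mat_power_sum (\<lambda>l. - g' s l) k N * F s) (at s within D)"
      unfolding F_def using g[OF s] by (intro exp_mat_power_sum_derivative[OF N] DERIV_minus)
    then have dF: "has_mat_derivative n F (- ?V * F s) (at s within D)"
      by (simp only: mat_power_sum_uminus[OF N])
    have dL: "has_mat_derivative n ?L (- N) (at s within D)"
      unfolding has_mat_derivative_def
    proof (intro allI impI)
      fix i j assume ij: "i < n" "j < n"
      have "((\<lambda>s. (if i = j then 1 else 0) - s * N $$ (i, j)) has_field_derivative - N $$ (i, j)) (at s within D)"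
        by (auto intro!: derivative_eq_intros)
      then show "((\<lambda>s. ?L s $$ (i, j)) has_field_derivative (- N) $$ (i, j)) (at s within D)"
        using N ij by simp
    qed
    have FV: "F s * ?V = ?V * F s" unfolding F_def
      using N by (intro exp_mat_commute[of _ n] mat_power_sum_commute[of _ n]
          mat_power_sum_commute[of _ n, symmetric]) auto
    \<comment> \<open>The equation has L on the left; both orders of the product expand to the same
      matrix because \<open>?V\<close> is a polynomial in \<open>N\<close>.\<close>
    have LV: "?V * ?L s = - N"
      using ode[OF s] mat_power_sum_commute[OF N N refl, of "g' s" k]
      by (simp only: mult_minus_one_smult[OF V N])
    have "- ?V * F s * ?L s + F s * (- N) = 0\<^sub>m n n"
    proof -
      have dims: "dim_col (F s) = n" "dim_row (F s) = n" "dim_col ?V = n" "dim_row ?V = n"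
        "dim_row (?L s) = n" using F[of s] V L[of s] by auto
      have "- ?V * F s = - (F s * ?V)"
        using uminus_mult_left_mat[of ?V "F s"] dims FV by simp
      then have "- ?V * F s * ?L s = - (F s * ?V * ?L s)"
        using uminus_mult_left_mat[of "F s * ?V" "?L s"] dims by simp
      also have "\<dots> = - (F s * - N)"
        by (simp only: assoc_mult_mat[OF F V L] LV)
      finally show ?thesis using mult_carrier_mat[OF F[of s] uminus_carrier_mat[OF N]]
        by (simp only: uminus_l_inv_mat)
    qed
    then show ?thesis
      using has_mat_derivative_mult[OF F mult_carrier_mat[OF uminus_carrier_mat[OF V] F] L
          uminus_carrier_mat[OF N] dF dL] by simp
  qed
  have "F t * ?L t = F 0 * ?L 0"
  proof (rule eq_matI)
    fix i j assume "i < dim_row (F 0 * ?L 0)" "j < dim_col (F 0 * ?L 0)"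
    then have ij: "i < n" "j < n" using N F[of 0] by auto
    show "(F t * ?L t) $$ (i, j) = (F 0 * ?L 0) $$ (i, j)"
    proof (rule has_real_derivative_zero_constant_interval[OF _ _ t D(2)])
      show "((\<lambda>s. (F s * ?L s) $$ (i, j)) has_field_derivative 0) (at s within D)" if "s \<in> D" for s
        using const[OF that] ij by (simp add: has_mat_derivative_def del: index_mult_mat)
    qed (rule D(1))
  qed (use N F[of t] F[of 0] in auto)
  moreover have "F 0 = 1\<^sub>m n"
  proof -
    have "mat_power_sum (\<lambda>l. - g l 0) k N = 0\<^sub>m n n"
      using N by (intro eq_matI) (auto simp: mat_power_sum_def init)
    then show ?thesis by (simp add: F_def exp_mat_zero)
  qed
  moreover have "?L 0 = 1\<^sub>m n" using N by (intro eq_matI) auto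
  ultimately have FL: "F t * ?L t = 1\<^sub>m n" by simp
  have "exp_mat (?X t) = exp_mat (?X t) * (F t * ?L t)"
    unfolding FL right_mult_one_mat[OF exp_mat_carrier[OF X]] ..
  also have "\<dots> = exp_mat (?X t) * exp_mat (- ?X t) * ?L t"
    unfolding F_eq
    by (rule assoc_mult_mat[OF exp_mat_carrier[OF X] exp_mat_carrier[OF uminus_carrier_mat[OF X]] L, symmetric])
  also have "\<dots> = ?L t" unfolding exp_mat_uminus_right[OF X] by (rule left_mult_one_mat[OF L])
  finally show ?thesis .
qed

section \<open>The principal logarithm\<close>

lemma pencil_eigenvector:
  assumes N: "N \<in> carrier_mat n n" and u: "u \<in> carrier_vec n"
    and eig: "map_mat complex_of_real N *\<^sub>v u = z \<cdot>\<^sub>v u"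
  shows "map_mat complex_of_real (1\<^sub>m n - t \<cdot>\<^sub>m N) *\<^sub>v u = (1 - of_real t * z) \<cdot>\<^sub>v u"
proof -
  let ?N = "map_mat complex_of_real N"
  have cN: "?N \<in> carrier_mat n n" using N by simp
  have "map_mat complex_of_real (1\<^sub>m n - t \<cdot>\<^sub>m N) = 1\<^sub>m n - of_real t \<cdot>\<^sub>m ?N"
    using N by (intro eq_matI) auto
  moreover have "(of_real t \<cdot>\<^sub>m ?N) *\<^sub>v u = of_real t \<cdot>\<^sub>v (?N *\<^sub>v u)"
    using cN u by (intro eq_vecI) auto
  ultimately show ?thesis
    using minus_mult_distrib_mat_vec[OF one_carrier_mat smult_carrier_mat[OF cN] u] u
    by (auto simp: eig algebra_simps intro!: eq_vecI)
qed

lemma pencil_eigenvector_rev: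
  assumes N: "N \<in> carrier_mat n n" and u: "u \<in> carrier_vec n" and t: "t \<noteq> 0"
    and eig: "map_mat complex_of_real (1\<^sub>m n - t \<cdot>\<^sub>m N) *\<^sub>v u = z \<cdot>\<^sub>v u"
  shows "map_mat complex_of_real N *\<^sub>v u = ((1 - z) / of_real t) \<cdot>\<^sub>v u"
proof (rule eq_vecI)
  let ?N = "map_mat complex_of_real N"
  have cN: "?N \<in> carrier_mat n n" using N by simp
  have e: "map_mat complex_of_real (1\<^sub>m n - t \<cdot>\<^sub>m N) = 1\<^sub>m n - of_real t \<cdot>\<^sub>m ?N"
    using N by (intro eq_matI) auto
  have s: "(of_real t \<cdot>\<^sub>m ?N) *\<^sub>v u = of_real t \<cdot>\<^sub>v (?N *\<^sub>v u)"
    using cN u by (intro eq_vecI) auto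
  have "u - of_real t \<cdot>\<^sub>v (?N *\<^sub>v u) = z \<cdot>\<^sub>v u"
    using eig minus_mult_distrib_mat_vec[OF one_carrier_mat smult_carrier_mat[OF cN] u] u
    by (simp add: e s)
  moreover fix i assume "i < dim_vec (((1 - z) / of_real t) \<cdot>\<^sub>v u)"
  then have i: "i < n" using u by simp
  ultimately have "(u - of_real t \<cdot>\<^sub>v (?N *\<^sub>v u)) $ i = (z \<cdot>\<^sub>v u) $ i" by simp
  then have "u $ i - of_real t * (?N *\<^sub>v u) $ i = z * u $ i"
    using i u N by (simp del: index_mult_mat_vec)
  then show "(?N *\<^sub>v u) $ i = (((1 - z) / of_real t) \<cdot>\<^sub>v u) $ i"
    using i u t by (simp add: field_simps del: index_mult_mat_vec)
qed (use N u in auto)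

lemma one_minus_not_negative:
  assumes N: "N \<in> carrier_mat n n" and u: "u \<in> carrier_vec n" "u \<noteq> 0\<^sub>v n"
    and eig: "map_mat complex_of_real N *\<^sub>v u = z \<cdot>\<^sub>v u"
    and t: "cspectrum (1\<^sub>m n - t \<cdot>\<^sub>m N) \<inter> closed_negative_axis = {}"
  shows "1 - of_real t * z \<notin> closed_negative_axis"
proof -
  have "1\<^sub>m n - t \<cdot>\<^sub>m N \<in> carrier_mat n n" using N by (simp add: minus_carrier_mat)
  then have "1 - of_real t * z \<in> cspectrum (1\<^sub>m n - t \<cdot>\<^sub>m N)"
    using pencil_eigenvector[OF N u(1) eig, of t] u by (auto simp: cspectrum_iff)
  then show ?thesis using t by blast
qed

lemma zero_in_pencil_domain:
  assumes N: "N \<in> carrier_mat n n"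
  shows "cspectrum (1\<^sub>m n - 0 \<cdot>\<^sub>m N) \<inter> closed_negative_axis = {}"
proof -
  have C: "1\<^sub>m n - 0 \<cdot>\<^sub>m N \<in> carrier_mat n n" using N by (simp add: minus_carrier_mat)
  have e: "map_mat complex_of_real (1\<^sub>m n - 0 \<cdot>\<^sub>m N) = 1\<^sub>m n" using N by (intro eq_matI) auto
  have "z = 1" if "z \<in> cspectrum (1\<^sub>m n - 0 \<cdot>\<^sub>m N)" for z
  proof -
    obtain u where u: "u \<in> carrier_vec n" "u \<noteq> 0\<^sub>v n" "1\<^sub>m n *\<^sub>v u = z \<cdot>\<^sub>v u"
      using \<open>z \<in> _\<close> unfolding cspectrum_iff[OF C] e by blast
    then have "1 \<cdot>\<^sub>v u = z \<cdot>\<^sub>v u" by simp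
    then show ?thesis using smult_vec_cancel[OF u(1,2)] by metis
  qed
  moreover have "1 \<notin> closed_negative_axis"
    by (auto simp: closed_negative_axis_def complex_eq_iff)
  ultimately show ?thesis by blast
qed

text \<open>If \<open>t\<close> is excluded, some real eigenvalue q of \<open>N\<close> satisfies 1
  - tq \<le> 0. The function s -> 1 - sq is affine and positive at \<open>x\<close> and
  \<open>y\<close>, hence positive in between, a contradiction.\<close>

lemma pencil_domain_interval:
  assumes N: "N \<in> carrier_mat n n"
    and x: "cspectrum (1\<^sub>m n - x \<cdot>\<^sub>m N) \<inter> closed_negative_axis = {}"
    and y: "cspectrum (1\<^sub>m n - y \<cdot>\<^sub>m N) \<inter> closed_negative_axis = {}"
    and "x \<le> t" "t \<le> y"
  shows "cspectrum (1\<^sub>m n - t \<cdot>\<^sub>m N) \<inter> closed_negative_axis = {}"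
proof (rule ccontr)
  assume "\<not> ?thesis"
  then obtain r where r: "complex_of_real r \<in> cspectrum (1\<^sub>m n - t \<cdot>\<^sub>m N)" "r \<le> 0"
    by (auto simp: closed_negative_axis_def)
  have t: "t \<noteq> 0"
    using zero_in_pencil_domain[OF N] r by (auto simp: closed_negative_axis_def)
  have C: "1\<^sub>m n - t \<cdot>\<^sub>m N \<in> carrier_mat n n" using N by (simp add: minus_carrier_mat)
  obtain u where u: "u \<in> carrier_vec n" "u \<noteq> 0\<^sub>v n"
      "map_mat complex_of_real (1\<^sub>m n - t \<cdot>\<^sub>m N) *\<^sub>v u = complex_of_real r \<cdot>\<^sub>v u"
    using r(1) unfolding cspectrum_iff[OF C] by blast
  \<comment> \<open>Solves 1 - tq = r, and is real because r is.\<close>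
  define q where "q = (1 - r) / t"
  have "(1 - complex_of_real r) / of_real t = of_real q" by (simp add: q_def)
  then have eig: "map_mat complex_of_real N *\<^sub>v u = of_real q \<cdot>\<^sub>v u"
    using pencil_eigenvector_rev[OF N u(1) t u(3)] by simp
  have pos: "1 - s * q > 0" if "cspectrum (1\<^sub>m n - s \<cdot>\<^sub>m N) \<inter> closed_negative_axis = {}" for s
  proof -
    have "complex_of_real (1 - s * q) \<notin> closed_negative_axis"
      using one_minus_not_negative[OF N u(1,2) eig that] by simp
    then show ?thesis
      unfolding closed_negative_axis_def by (meson atMost_iff imageI not_le)
  qed
  have "t * q \<le> max (x * q) (y * q)"
  proof (cases "q \<ge> 0")
    case True
    then show ?thesis using mult_right_mono[OF \<open>t \<le> y\<close>] by (simp add: le_max_iff_disj)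
  next
    case False
    then show ?thesis using mult_right_mono_neg[OF \<open>x \<le> t\<close>, of q] by (simp add: le_max_iff_disj)
  qed
  then have "t * q < 1" using pos[OF x] pos[OF y] by auto
  then show False using t r(2) by (simp add: q_def)
qed

text \<open>On the lines Im = pi and Im = -pi the exponential takes the negative values -exp(Re). So
  the imaginary parts of \<open>h\<close> form a connected set of reals that contains 0 and misses
  both pi and -pi.\<close>

lemma log_branch_in_strip:
  fixes h :: "real \<Rightarrow> complex"
  assumes D: "connected D" and h: "continuous_on D h"
    and a: "a \<in> D" "h a = 0" and b: "b \<in> D"
    and E: "\<And>s. s \<in> D \<Longrightarrow> exp (h s) \<notin> closed_negative_axis"
  shows "- pi < Im (h b) \<and> Im (h b) < pi"
proof -
  have conn: "connected ((\<lambda>s. Im (h s)) ` D)"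
    using D h by (intro connected_continuous_image continuous_intros)
  have not: "c \<notin> (\<lambda>s. Im (h s)) ` D" if c: "\<bar>c\<bar> = pi" for c
  proof
    assume "c \<in> (\<lambda>s. Im (h s)) ` D"
    then obtain s where s: "s \<in> D" "Im (h s) = c" by auto
    have "cos c = - 1" "sin c = 0" using c by (auto simp: abs_eq_iff')
    then have "exp (h s) = complex_of_real (- exp (Re (h s)))"
      using s by (simp add: complex_eq_iff Re_exp Im_exp)
    moreover have "- exp (Re (h s)) \<in> {..0}" by simp
    ultimately have "exp (h s) \<in> closed_negative_axis"
      unfolding closed_negative_axis_def by (rule image_eqI)
    then show False using E s by blast
  qed
  have "Im (h b) \<in> (\<lambda>s. Im (h s)) ` D" "0 \<in> (\<lambda>s. Im (h s)) ` D"
    using a b by (auto intro!: image_eqI[of _ _ a])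
  then have "\<not> pi \<le> Im (h b)" "\<not> Im (h b) \<le> - pi"
    using connectedD_interval[OF conn, of 0 "Im (h b)" pi]
      connectedD_interval[OF conn, of "Im (h b)" 0 "- pi"] not[of pi] not[of "- pi"] by auto
  then show ?thesis by linarith
qed

text \<open>The eigenspace of X(t) for z is invariant under \<open>N\<close> and so contains an
  eigenvector u of \<open>N\<close>, with eigenvalue y say. Every X(s) is a polynomial in the same
  \<open>N\<close>, so u belongs to all of them, with the eigenvalue h(s) obtained by putting y for
  \<open>N\<close>. Thus z = h(t) lies on a continuous curve starting at 0.\<close>

lemma log_ode_cspectrum_strip:
  fixes N :: "real mat"
  assumes N: "N \<in> carrier_mat n n" and D: "connected D" "0 \<in> D"
    and spec: "\<And>s. s \<in> D \<Longrightarrow> cspectrum (1\<^sub>m n - s \<cdot>\<^sub>m N) \<inter> closed_negative_axis = {}"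
    and g: "\<And>l. l < k \<Longrightarrow> continuous_on D (g l)" and init: "\<And>l. l < k \<Longrightarrow> g l 0 = 0"
    and E: "\<And>s. s \<in> D \<Longrightarrow> exp_mat (mat_power_sum (\<lambda>l. g l s) k N) = 1\<^sub>m n - s \<cdot>\<^sub>m N"
    and t: "t \<in> D"
  shows "\<forall>z\<in>cspectrum (mat_power_sum (\<lambda>l. g l t) k N). - pi < Im z \<and> Im z < pi"
proof
  let ?X = "\<lambda>s. mat_power_sum (\<lambda>l. g l s) k N" and ?C = "map_mat complex_of_real"
  have X: "?X s \<in> carrier_mat n n" for s using N by simp
  have cX: "?C (?X t) \<in> carrier_mat n n" and cN: "?C N \<in> carrier_mat n n" using X N by auto
  have comm: "?C (?X t) * ?C N = ?C N * ?C (?X t)"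
    using of_real_hom.mat_hom_mult[OF X N, where ?'a = complex]
      of_real_hom.mat_hom_mult[OF N X, where ?'a = complex] mat_power_sum_commute[OF N N refl]
    by metis
  fix z assume "z \<in> cspectrum (?X t)"
  then obtain w where w: "w \<in> carrier_vec n" "w \<noteq> 0\<^sub>v n" "?C (?X t) *\<^sub>v w = z \<cdot>\<^sub>v w"
    using cspectrum_iff[OF X] by blast
  define S where "S = {v \<in> carrier_vec n. ?C (?X t) *\<^sub>v v = z \<cdot>\<^sub>v v}"
  have S: "S \<subseteq> carrier_vec n" by (auto simp: S_def)
  have add: "v + w \<in> S" if "v \<in> S" "w \<in> S" for v w
    using that by (simp add: S_def mult_add_distrib_mat_vec[OF cX] smult_add_distrib_vec[of _ n])
  have smult: "c \<cdot>\<^sub>v v \<in> S" if "v \<in> S" for c v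
    using that by (simp add: S_def mult_mat_vec[OF cX] smult_smult_assoc mult.commute)
  have inv: "?C N *\<^sub>v v \<in> S" if v: "v \<in> S" for v
  proof -
    have vc: "v \<in> carrier_vec n" and ev: "?C (?X t) *\<^sub>v v = z \<cdot>\<^sub>v v" using v by (auto simp: S_def)
    have "?C (?X t) *\<^sub>v (?C N *\<^sub>v v) = ?C N *\<^sub>v (?C (?X t) *\<^sub>v v)"
      using assoc_mult_mat_vec[OF cX cN vc] assoc_mult_mat_vec[OF cN cX vc] comm by metis
    then show ?thesis
      unfolding S_def ev mult_mat_vec[OF cN vc] using mult_mat_vec_carrier[OF cN vc] by blast
  qed
  have wS: "w \<in> S" using w by (simp add: S_def)
  obtain u y where u: "u \<in> S" "u \<noteq> 0\<^sub>v n" and uN: "?C N *\<^sub>v u = y \<cdot>\<^sub>v u"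
    using eigenvector_in_invariant_subspace[OF cN S add smult inv wS w(2)] by blast
  have uc: "u \<in> carrier_vec n" and uX: "?C (?X t) *\<^sub>v u = z \<cdot>\<^sub>v u" using u by (auto simp: S_def)
  define h where "h s = (\<Sum>l<k. complex_of_real (g l s) * y ^ l)" for s
  have hX: "?C (?X s) *\<^sub>v u = h s \<cdot>\<^sub>v u" for s
    unfolding h_def by (rule mat_power_sum_eigenvector[OF N uc uN])
  have z: "z = h t" using smult_vec_cancel[OF uc u(2)] hX[of t] uX by simp
  have "exp (h s) \<notin> closed_negative_axis" if s: "s \<in> D" for s
  proof -
    have "exp (h s) \<cdot>\<^sub>v u = (1 - of_real s * y) \<cdot>\<^sub>v u"
      using exp_mat_eigenvector[OF X uc hX] pencil_eigenvector[OF N uc uN] E[OF s] by metis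
    then have "exp (h s) = 1 - of_real s * y" by (rule smult_vec_cancel[OF uc u(2)])
    then show ?thesis using one_minus_not_negative[OF N uc u(2) uN spec[OF s]] by simp
  qed
  moreover have "continuous_on D h" unfolding h_def using g by (intro continuous_intros) auto
  moreover have "h 0 = 0" by (simp add: h_def init)
  ultimately show "- pi < Im z \<and> Im z < pi"
    unfolding z using log_branch_in_strip[OF D(1) _ D(2) _ t] by blast
qed

text \<open>\<open>log_mat\<close> demands uniqueness among all real matrices, not just polynomials
  in \<open>N\<close>. A competitor Y commutes with its own exponential I - tN, which yields
  commutation with \<open>N\<close> only if t is nonzero. At t = 0 the matrix I - tN retains nothing
  of \<open>N\<close>; hence the separate hypothesis that the candidate is zero there.\<close>

lemma log_mat_eq_power_sum:
  assumes N: "N \<in> carrier_mat n n"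
    and E: "exp_mat (mat_power_sum c k N) = 1\<^sub>m n - t \<cdot>\<^sub>m N"
    and zero: "t = 0 \<Longrightarrow> mat_power_sum c k N = 0\<^sub>m n n"
    and strip: "\<forall>z\<in>cspectrum (mat_power_sum c k N). - pi < Im z \<and> Im z < pi"
  shows "log_mat (1\<^sub>m n - t \<cdot>\<^sub>m N) = mat_power_sum c k N"
proof -
  let ?X = "mat_power_sum c k N" and ?B = "1\<^sub>m n - t \<cdot>\<^sub>m N"
  have X: "?X \<in> carrier_mat n n" and dim: "dim_row ?B = n" using N by auto
  have unique: "Y = ?X" if Y: "Y \<in> carrier_mat n n" "exp_mat Y = ?B"
      "\<forall>z\<in>cspectrum Y. - pi < Im z \<and> Im z < pi" for Y
  proof -
    have comm: "?X * Y = Y * ?X"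
    proof (cases "t = 0")
      case True
      then show ?thesis using zero Y(1) by simp
    next
      case False
      have "?B * Y = Y * ?B"
        unfolding Y(2)[symmetric] by (rule exp_mat_commute[OF Y(1) Y(1) refl])
      then have e: "Y - t \<cdot>\<^sub>m (N * Y) = Y - t \<cdot>\<^sub>m (Y * N)"
        unfolding mult_minus_one_smult[OF Y(1) N] .
      have "N * Y = Y * N"
      proof (rule eq_matI)
        fix i j assume "i < dim_row (Y * N)" "j < dim_col (Y * N)"
        then have ij: "i < n" "j < n" using Y N by auto
        have "(Y - t \<cdot>\<^sub>m (N * Y)) $$ (i, j) = (Y - t \<cdot>\<^sub>m (Y * N)) $$ (i, j)"
          by (simp only: e)
        then show "(N * Y) $$ (i, j) = (Y * N) $$ (i, j)"
          using ij Y(1) N False by (simp del: index_mult_mat(1))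
      qed (use Y N in auto)
      then show ?thesis by (rule mat_power_sum_commute[OF N Y(1)])
    qed
    have "?X = Y"
      by (rule exp_mat_inject_strip[OF X Y(1) comm _ strip Y(3)]) (simp only: E Y(2))
    then show ?thesis by (rule sym)
  qed
  show ?thesis
    unfolding log_mat_def dim
  proof (rule the_equality)
    show "?X \<in> carrier_mat n n \<and> exp_mat ?X = ?B \<and> (\<forall>z\<in>cspectrum ?X. - pi < Im z \<and> Im z < pi)"
      using X E strip by blast
  qed (use unique in blast)
qed

theorem mainTheorem3:
  fixes A C :: "real mat" and n k :: nat and p :: "real poly"
    and D :: "real set" and f :: "nat \<Rightarrow> real \<Rightarrow> real"
  assumes "A \<in> carrier_mat n n"
    and "cspectrum A \<inter> closed_negative_axis = {}"
    and "k \<ge> 2"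
    and "degree p = k" and "lead_coeff p = 1"
    and "poly_mat p (1\<^sub>m n - A) = 0\<^sub>m n n"
    and "C = companion_mat p"
    and "D = {t. cspectrum (1\<^sub>m n - t \<cdot>\<^sub>m (1\<^sub>m n - A)) \<inter> closed_negative_axis = {}}"
    and "ivp_solution k D (\<lambda>t. 1\<^sub>m k - t \<cdot>\<^sub>m C) (- unit_vec k 1) (0\<^sub>v k)
           (\<lambda>t. vec k (\<lambda>i. f (Suc i) t))"
  shows "(\<forall>t\<in>{0..1}. log_mat ((1 - t) \<cdot>\<^sub>m 1\<^sub>m n + t \<cdot>\<^sub>m A) =
            mat_power_sum (\<lambda>j. f (Suc j) t) k (1\<^sub>m n - A)) \<and>
         (\<forall>t\<in>D. log_mat ((1 - t) \<cdot>\<^sub>m 1\<^sub>m n + t \<cdot>\<^sub>m A) =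
            mat_power_sum (\<lambda>j. f (Suc j) t) k (1\<^sub>m n - A)) \<and>
         log_mat A = mat_power_sum (\<lambda>j. f (Suc j) 1) k (1\<^sub>m n - A)"
proof -
  define N where "N = 1\<^sub>m n - A"
  note A = assms(1)
  have N: "N \<in> carrier_mat n n" using A by (simp add: N_def minus_carrier_mat)
  have pencil: "(1 - t) \<cdot>\<^sub>m 1\<^sub>m n + t \<cdot>\<^sub>m A = 1\<^sub>m n - t \<cdot>\<^sub>m N" for t
    using A by (intro eq_matI) (auto simp: N_def algebra_simps)
  \<comment> \<open>\<open>A\<close> is the value of I - tN at t = 1, so the hypothesis on its
    spectrum says exactly that 1 lies in D.\<close>
  have A_pencil: "A = 1\<^sub>m n - 1 \<cdot>\<^sub>m N" using A by (intro eq_matI) (auto simp: N_def)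
  have D_iff: "t \<in> D \<longleftrightarrow> cspectrum (1\<^sub>m n - t \<cdot>\<^sub>m N) \<inter> closed_negative_axis = {}" for t
    using assms(8) by (simp add: N_def)
  have D0: "0 \<in> D" using zero_in_pencil_domain[OF N] D_iff by simp
  have D1: "1 \<in> D" unfolding D_iff A_pencil[symmetric] by (rule assms(2))
  have D_interval: "z \<in> D" if "x \<in> D" "y \<in> D" "x \<le> z" "z \<le> y" for x y z
    using pencil_domain_interval[OF N] that unfolding D_iff by blast
  \<comment> \<open>The components f_1, ..., f_k are numbered from 1 and vector entries from 0,
    whence \<open>Suc i\<close>.\<close>
  have "\<exists>v. v \<in> carrier_vec k \<and>
      (\<forall>i<k. (f (Suc i) has_real_derivative v $ i) (at t within D)) \<and>
      (1\<^sub>m k - t \<cdot>\<^sub>m companion_mat p) *\<^sub>v v = - unit_vec k 1" if "t \<in> D" for t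
    using assms(9) that unfolding ivp_solution_def assms(7)
    by (simp add: Bex_def cong: conj_cong)
  then obtain v where v: "\<And>t. t \<in> D \<Longrightarrow> v t \<in> carrier_vec k"
      "\<And>t i. t \<in> D \<Longrightarrow> i < k \<Longrightarrow> (f (Suc i) has_real_derivative v t $ i) (at t within D)"
      "\<And>t. t \<in> D \<Longrightarrow> (1\<^sub>m k - t \<cdot>\<^sub>m companion_mat p) *\<^sub>v v t = - unit_vec k 1"
    by metis
  have init: "f (Suc i) 0 = 0" if "i < k" for i
  proof -
    have "vec k (\<lambda>i. f (Suc i) 0) = 0\<^sub>v k" using assms(9) by (simp add: ivp_solution_def)
    from arg_cong[OF this, of "\<lambda>v. v $ i"] show ?thesis using that by simp
  qed
  have ode: "(1\<^sub>m n - t \<cdot>\<^sub>m N) * mat_power_sum (\<lambda>l. v t $ l) k N = - N" if "t \<in> D" for t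
    using companion_ode_annihilated[OF N assms(4,3,5) assms(6)[folded N_def] v(1,3)[OF that]] .
  have E: "exp_mat (mat_power_sum (\<lambda>j. f (Suc j) t) k N) = 1\<^sub>m n - t \<cdot>\<^sub>m N" if "t \<in> D" for t
    by (rule exp_mat_of_log_ode[OF N D_interval D0 v(2) ode init that])
  have "connected D" using D_interval by (intro connectedI_interval)
  moreover have "continuous_on D (f (Suc l))" if "l < k" for l
    using v(2)[OF _ that] by (rule DERIV_continuous_on)
  ultimately have strip:
    "\<forall>z\<in>cspectrum (mat_power_sum (\<lambda>j. f (Suc j) t) k N). - pi < Im z \<and> Im z < pi" if "t \<in> D" for t
    using log_ode_cspectrum_strip[OF N _ D0 _ _ init E that] D_iff by blast
  have main: "log_mat (1\<^sub>m n - t \<cdot>\<^sub>m N) = mat_power_sum (\<lambda>j. f (Suc j) t) k N" if "t \<in> D" for t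
  proof (rule log_mat_eq_power_sum[OF N E[OF that] _ strip[OF that]])
    assume "t = 0"
    then show "mat_power_sum (\<lambda>j. f (Suc j) t) k N = 0\<^sub>m n n"
      using N by (intro eq_matI) (auto simp: mat_power_sum_def init)
  qed
  \<comment> \<open>Both end points lie in D, and D is an interval.\<close>
  have "{0..1} \<subseteq> D" using D_interval[OF D0 D1] by auto
  then have "\<forall>t\<in>{0..1}. log_mat (1\<^sub>m n - t \<cdot>\<^sub>m N) = mat_power_sum (\<lambda>j. f (Suc j) t) k N"
    using main by blast
  moreover have "log_mat A = mat_power_sum (\<lambda>j. f (Suc j) 1) k N"
    by (subst A_pencil) (rule main[OF D1])
  ultimately show ?thesis
    unfolding pencil N_def[symmetric] using main by blast
qed

end
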